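(* Let $0 < \epsilon < \frac12$ be fixed and let $h \geq 1$ be an integer. Let $\mathcal H$ be a graph class such that each graph $G \in \mathcal H$ has a partition of $V(G)$ into parts $U_1,\dots,U_k$, each of size at most $t = (\log d)^{\epsilon}$, such that each connected component of the quotient graph $G/(U_1,\dots,U_k)$ has treedepth at most $h$. Then, as $d \to \infty$, \[ \ell_{\mathcal H}(d) \leq \frac{h-1+o_h(1)}{1-2\epsilon}\cdot \frac{\log d}{\log \log d}. \]
   Context: All graphs are finite. Let $\mathcal G = \{G_1,\dots,G_k\}$ be a family of graphs, where $G_i$ has vertex set $V_i$ (the sets $V_i$ may overlap), and let $V = V_1\cup\dots\cup V_k$. A cooperative list coloring of $\mathcal G$ is a family of sets $R_1,\dots,R_k$ with $R_i \subseteq V_i$, each $R_i$ an independent set of $G_i$, and $V = \bigcup_{i=1}^k R_i$. For a graph class $\mathcal H$, $\ell_{\mathcal H}(d)$ denotes the minimum value $\ell$ such that whenever $\mathcal G$ is a family of graphs from $\mathcal H$, each of maximum degree at most $d$, whose vertex sets are subsets of a universal vertex set $V$, and each vertex of $V$ belongs to at least $\ell$ graphs of $\mathcal G$, then $\mathcal G$ has a cooperative list coloring. (Here the class $\mathcal H$ may depend on $d$ through $t$.) If $U_1,\dots,U_k$ is a partition of $V(G)$, the quotient graph $G/(U_1,\dots,U_k)$ is the graph on $k$ vertices obtained by contracting each $U_i$ to a single vertex and deleting all loops and parallel edges. In a rooted tree with root $r$, the height of a vertex is its distance to $r$, and the tree's height is the maximum height of its vertices. The closure of a rooted tree $T$ is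 the graph on $V(T)$ in which two vertices are adjacent iff one is an ancestor of the other. A graph $G$ has treedepth at most $h$ if there is a rooted tree $T$ of height $h-1$ such that $G$ is a subgraph of the closure of $T$. Logarithms are natural; $o_h(1)$ denotes a function tending to $0$ as $d\to\infty$ whose rate may depend on $h$ (and $\epsilon$). *)

theory Defs
  imports Complex_Main
begin

type_synonym 'v graph = "'v set \<times> ('v \<times> 'v) set"

definition verts :: "'v graph \<Rightarrow> 'v set" where "verts G = fst G"
definition edges :: "'v graph \<Rightarrow> ('v \<times> 'v) set" where "edges G = snd G"

definition wf_graph :: "'v graph \<Rightarrow> bool" where
  "wf_graph G \<longleftrightarrow> finite (verts G) \<and> edges G \<subseteq> verts G \<times> verts G
     \<and> sym (edges G) \<and> irrefl (edges G)"

definition degree :: "'v graph \<Rightarrow> 'v \<Rightarrow> nat" where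
  "degree G v = card {u. (v, u) \<in> edges G}"

definition max_degree_le :: "'v graph \<Rightarrow> nat \<Rightarrow> bool" where
  "max_degree_le G d \<longleftrightarrow> (\<forall>v\<in>verts G. degree G v \<le> d)"

definition independent :: "'v graph \<Rightarrow> 'v set \<Rightarrow> bool" where
  "independent G R \<longleftrightarrow> R \<subseteq> verts G \<and> (\<forall>x\<in>R. \<forall>y\<in>R. (x, y) \<notin> edges G)"

definition coop_colorable :: "nat \<Rightarrow> (nat \<Rightarrow> 'v graph) \<Rightarrow> bool" where
  "coop_colorable k Gs \<longleftrightarrow>
     (\<exists>R :: nat \<Rightarrow> 'v set.
        (\<forall>i<k. R i \<subseteq> verts (Gs i) \<and> independent (Gs i) (R i)) \<and>
        (\<Union>i<k. verts (Gs i)) = (\<Union>i<k. R i))"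

definition coop_property :: "'v graph set \<Rightarrow> nat \<Rightarrow> nat \<Rightarrow> bool" where
  "coop_property H d l \<longleftrightarrow>
     (\<forall>(k::nat) (Gs :: nat \<Rightarrow> 'v graph).
        (\<forall>i<k. Gs i \<in> H \<and> wf_graph (Gs i) \<and> max_degree_le (Gs i) d) \<and>
        (\<forall>v\<in>(\<Union>i<k. verts (Gs i)). l \<le> card {i. i < k \<and> v \<in> verts (Gs i)})
        \<longrightarrow> coop_colorable k Gs)"

definition ell :: "'v graph set \<Rightarrow> nat \<Rightarrow> nat" where
  "ell H d = (LEAST l. coop_property H d l)"

definition rooted_tree :: "'a set \<Rightarrow> 'a \<Rightarrow> ('a \<Rightarrow> 'a) \<Rightarrow> bool" where
  "rooted_tree VT r par \<longleftrightarrow> finite VT \<and> r \<in> VT \<and> par r = r \<and>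
     (\<forall>v\<in>VT. par v \<in> VT) \<and> (\<forall>v\<in>VT. \<exists>n. (par ^^ n) v = r)"

definition vheight :: "'a \<Rightarrow> ('a \<Rightarrow> 'a) \<Rightarrow> 'a \<Rightarrow> nat" where
  "vheight r par v = (LEAST n. (par ^^ n) v = r)"

definition tree_height :: "'a set \<Rightarrow> 'a \<Rightarrow> ('a \<Rightarrow> 'a) \<Rightarrow> nat" where
  "tree_height VT r par = Max (vheight r par ` VT)"

definition closure_adj :: "('a \<Rightarrow> 'a) \<Rightarrow> 'a \<Rightarrow> 'a \<Rightarrow> bool" where
  "closure_adj par x y \<longleftrightarrow> x \<noteq> y \<and> (\<exists>n. (par ^^ n) x = y \<or> (par ^^ n) y = x)"

definition treedepth_le :: "'a graph \<Rightarrow> nat \<Rightarrow> bool" where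
  "treedepth_le G h \<longleftrightarrow>
     (\<exists>VT r par. rooted_tree VT r par \<and> verts G \<subseteq> VT \<and> tree_height VT r par \<le> h - 1 \<and>
        (\<forall>(x, y)\<in>edges G. closure_adj par x y))"

definition is_partition :: "'v set set \<Rightarrow> 'v set \<Rightarrow> bool" where
  "is_partition P V \<longleftrightarrow> \<Union>P = V \<and> {} \<notin> P \<and>
     (\<forall>A\<in>P. \<forall>B\<in>P. A \<noteq> B \<longrightarrow> A \<inter> B = {})"

definition quotient_graph :: "'v graph \<Rightarrow> 'v set set \<Rightarrow> 'v set graph" where
  "quotient_graph G P = (P, {(A, B). A \<in> P \<and> B \<in> P \<and> A \<noteq> B \<and>
      (\<exists>x\<in>A. \<exists>y\<in>B. (x, y) \<in> edges G)})"

definition component :: "'a graph \<Rightarrow> 'a \<Rightarrow> 'a graph" where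
  "component G x = (let C = {y \<in> verts G. (x, y) \<in> (edges G)\<^sup>*} in
      (C, edges G \<inter> (C \<times> C)))"

definition good_partition_graph :: "'v graph \<Rightarrow> real \<Rightarrow> nat \<Rightarrow> bool" where
  "good_partition_graph G t h \<longleftrightarrow>
     (\<exists>P. is_partition P (verts G) \<and> finite P \<and> (\<forall>U\<in>P. real (card U) \<le> t) \<and>
        (\<forall>A\<in>P. treedepth_le (component (quotient_graph G P) A) h))"

end

theory Submission
  imports Defs "HOL-Library.FuncSet" "HOL-Real_Asymp.Real_Asymp"
begin

text \<open>
  Give every vertex of a graph the height of its part in the tree as its level: adjacent vertices of
  different parts have different levels, every vertex has at most \<open>h t\<close> neighbours of lower level and
  at most \<open>t\<close> of its own level. Cut all lists to the length \<open>l\<close> and go through the levels. At level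
  \<open>n\<close>, every vertex that still has at least \<open>s T\<close> colours of level \<open>n\<close> not claimed by a neighbour
  of lower level, where \<open>T = 16 t\<close>, cuts these colours into segments of length \<open>s\<close> and claims a random
  colour from each of the first \<open>T\<close> segments, so that each claim has probability at most \<open>1 / s\<close>. A
  vertex that never claims anything has at least \<open>r = l - h s T\<close> blocked colours, which has probability
  at most \<open>2\<^bsup>l\<^esup> (h t / s)\<^bsup>r\<^esup>\<close>. This event is determined by the choices of the vertices reachable in at
  most \<open>h - 1\<close> steps to lower levels, so up to logarithmic factors it meets only \<open>d\<^bsup>h - 1\<^esup>\<close> others, and
  the local lemma lets every vertex claim at least \<open>T\<close> colours. Two adjacent vertices claiming the same
  colour have the same level in that graph, so each claimed colour has at most \<open>t\<close> conflicts, and the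
  local lemma again selects one claimed colour per vertex. For \<open>s = (log d)\<^bsup>1 - \<epsilon> - \<eta>\<^esup>\<close> with small
  \<open>\<eta>\<close>, the factor \<open>h t / s\<close> is about \<open>(log d)\<^bsup>2 \<epsilon> + \<eta> - 1\<^esup>\<close>, which yields the bound.
\<close>

section \<open>The local lemma on finite product spaces\<close>

text \<open>Independence of \<open>A\<close>, decided by the coordinates in \<open>J\<close>, and
  \<open>B\<close>, decided by the others, by an exchange argument: swapping the coordinates outside
  \<open>J\<close> between two points is an involution that turns a pair in
  \<open>A \<times> B\<close> into a point of \<open>A \<inter> B\<close> with an arbitrary
  companion, and back.\<close>

lemma card_PiE_independent:
  fixes S :: "'i \<Rightarrow> 's set"
  assumes I: "finite I" "\<And>i. i \<in> I \<Longrightarrow> finite (S i)"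
    and A: "A \<subseteq> PiE I S" "\<And>x y. x \<in> A \<Longrightarrow> y \<in> PiE I S \<Longrightarrow> (\<And>j. j \<in> J \<Longrightarrow> x j = y j) \<Longrightarrow> y \<in> A"
    and B: "B \<subseteq> PiE I S" "\<And>x y. x \<in> B \<Longrightarrow> y \<in> PiE I S \<Longrightarrow> (\<And>j. j \<notin> J \<Longrightarrow> x j = y j) \<Longrightarrow> y \<in> B"
  shows "card (A \<inter> B) * card (PiE I S) = card A * card B"
proof -
  define m where "m = (\<lambda>(x :: 'i \<Rightarrow> 's) y j. if j \<in> J then x j else y j)"
  have mO: "m x y \<in> PiE I S" if "x \<in> PiE I S" "y \<in> PiE I S" for x y
    using that by (auto simp: m_def PiE_iff extensional_def)
  have mm: "m (m x y) (m y x) = x" for x y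
    by (auto simp: m_def)
  have mA: "m x y \<in> A" if "x \<in> A" "y \<in> PiE I S" for x y
    using A(2)[OF that(1) mO[OF _ that(2)]] A(1) that by (auto simp: m_def)
  have mB: "m x y \<in> B" if "y \<in> B" "x \<in> PiE I S" for x y
    using B(2)[OF that(1) mO[OF that(2)]] B(1) that by (auto simp: m_def)
  have "bij_betw (\<lambda>(x, y). (m x y, m y x)) (A \<times> B) ((A \<inter> B) \<times> PiE I S)"
  proof (rule bij_betw_byWitness[where f' = "\<lambda>(x, y). (m x y, m y x)"])
    show "(\<lambda>(x, y). (m x y, m y x)) ` (A \<times> B) \<subseteq> (A \<inter> B) \<times> PiE I S"
      using A(1) B(1) by (auto intro!: mA mB mO)
    show "(\<lambda>(x, y). (m x y, m y x)) ` ((A \<inter> B) \<times> PiE I S) \<subseteq> A \<times> B"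
      using A(1) B(1) by (auto intro!: mA mB mO)
  qed (auto simp: mm)
  from bij_betw_same_card[OF this] show ?thesis
    by (simp add: card_cartesian_product)
qed

text \<open>Probabilities are counts in a finite product. Events whose sets \<open>J\<close> are
  disjoint depend on separate coordinates. The constant 4 in place of Euler's number permits a short
  induction in which all conditional probabilities stay at most \<open>2 * p\<close>.\<close>

theorem lovasz_local_lemma:
  fixes S :: "'i \<Rightarrow> 's set" and B :: "'e \<Rightarrow> ('i \<Rightarrow> 's) set" and p :: real
  assumes I: "finite I" "\<And>i. i \<in> I \<Longrightarrow> finite (S i) \<and> S i \<noteq> {}" and E: "finite E"
    and sub: "\<And>e. e \<in> E \<Longrightarrow> B e \<subseteq> PiE I S"
    and dep: "\<And>e x y. e \<in> E \<Longrightarrow> x \<in> B e \<Longrightarrow> y \<in> PiE I S \<Longrightarrow> (\<And>j. j \<in> J e \<Longrightarrow> x j = y j) \<Longrightarrow> y \<in> B e"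
    and p: "\<And>e. e \<in> E \<Longrightarrow> real (card (B e)) \<le> p * real (card (PiE I S))"
    and D: "\<And>e. e \<in> E \<Longrightarrow> card {f \<in> E. J e \<inter> J f \<noteq> {}} \<le> D"
    and pD: "4 * p * real D \<le> 1" "1 \<le> D" "0 \<le> p"
  shows "\<exists>x \<in> PiE I S. \<forall>e \<in> E. x \<notin> B e"
proof -
  let ?\<Omega> = "PiE I S"
  define good where "good F = {x \<in> ?\<Omega>. \<forall>f \<in> F. x \<notin> B f}" for F
  have fin: "finite ?\<Omega>"
    using I by (intro finite_PiE) auto
  have fing: "finite (good F)" for F
    using fin by (simp add: good_def)
  have pos: "0 < card ?\<Omega>"
    using I fin by (auto simp: card_gt_0_iff PiE_eq_empty_iff)
  have "p * 1 \<le> p * real D"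
    using pD by (intro mult_left_mono) auto
  then have p4: "4 * p \<le> 1"
    using pD by simp
  \<comment> \<open>The conditional probability of \<open>B e\<close>, given that all events in
    \<open>F\<close> fail, is at most \<open>2 * p\<close>. It is stated without division because
    \<open>good F\<close> is not yet known to be nonempty.\<close>
  have main: "real (card (B e \<inter> good F)) \<le> 2 * p * real (card (good F))"
    if "finite F" "F \<subseteq> E" "e \<in> E" for F e
    using that
  proof (induction "card F" arbitrary: F e rule: less_induct)
    case less
    define F1 where "F1 = {f \<in> F. J e \<inter> J f \<noteq> {}}"
    define F2 where "F2 = F - F1"
    have F12: "F = F1 \<union> F2" "F1 \<subseteq> F" "F2 \<subseteq> F" "finite F1" "finite F2"
      using less.prems by (auto simp: F1_def F2_def)
    have ind: "card (B e \<inter> good F2) * card ?\<Omega> = card (B e) * card (good F2)"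
    proof (rule card_PiE_independent[where J = "J e"])
      show "y \<in> good F2" if x: "x \<in> good F2" and y: "y \<in> PiE I S"
        and eq: "\<And>j. j \<notin> J e \<Longrightarrow> x j = y j" for x y
      proof -
        have "y \<notin> B f" if f: "f \<in> F2" for f
        proof
          assume "y \<in> B f"
          moreover have "f \<in> E" "J e \<inter> J f = {}"
            using f less.prems by (auto simp: F2_def F1_def)
          ultimately have "x \<in> B f"
            using x eq[symmetric] by (intro dep[of f y x]) (auto simp: good_def)
          then show False using x f by (auto simp: good_def)
        qed
        then show ?thesis using y by (auto simp: good_def)
      qed
      show "y \<in> B e" if "x \<in> B e" "y \<in> PiE I S" "\<And>j. j \<in> J e \<Longrightarrow> x j = y j" for x y
        using dep[OF less.prems(3) that] .
      show "B e \<subseteq> PiE I S" "good F2 \<subseteq> PiE I S"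
        using sub[OF less.prems(3)] by (auto simp: good_def)
    qed (use I in auto)
    have "real (card (B e \<inter> good F2)) * real (card ?\<Omega>) = real (card (B e)) * real (card (good F2))"
      using ind by (metis of_nat_mult)
    also have "\<dots> \<le> p * real (card ?\<Omega>) * real (card (good F2))"
      using p less.prems by (intro mult_right_mono) auto
    also have "\<dots> = p * real (card (good F2)) * real (card ?\<Omega>)"
      by (simp only: mult_ac)
    finally have le2: "real (card (B e \<inter> good F2)) \<le> p * real (card (good F2))"
      using pos by (simp only: mult_le_cancel_right)
    \<comment> \<open>Within \<open>good F2\<close>, each of the at most \<open>D\<close> events of
      \<open>F1\<close> has share at most \<open>2 * p\<close> by induction, so by
      \<open>4 * p * D \<le> 1\<close> they remove at most half of it.\<close>
    have half: "real (card (good F2)) \<le> 2 * real (card (good F))"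
    proof (cases "F1 = {}")
      case True
      then have "F2 = F"
        by (simp add: F2_def)
      then show ?thesis by simp
    next
      case False
      then have "F2 \<subset> F"
        using F12(2) by (auto simp: F2_def)
      then have "card F2 < card F"
        using less.prems(1) by (rule psubset_card_mono[rotated])
      then have IH: "real (card (B f \<inter> good F2)) \<le> 2 * p * real (card (good F2))" if "f \<in> F1" for f
        using less.hyps[of F2 f] F12(2,3,5) less.prems that by blast
      have "good F2 \<subseteq> good F \<union> (\<Union>f\<in>F1. B f \<inter> good F2)"
        by (subst F12(1)) (auto simp: good_def)
      then have "card (good F2) \<le> card (good F \<union> (\<Union>f\<in>F1. B f \<inter> good F2))"
        using fing F12(4) by (intro card_mono) auto
      also have "\<dots> \<le> card (good F) + (\<Sum>f\<in>F1. card (B f \<inter> good F2))"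
        using F12(4) by (intro order_trans[OF card_Un_le] add_left_mono card_UN_le) auto
      finally have "real (card (good F2)) \<le> real (card (good F)) + (\<Sum>f\<in>F1. real (card (B f \<inter> good F2)))"
        by (metis of_nat_add of_nat_le_iff of_nat_sum)
      also have "(\<Sum>f\<in>F1. real (card (B f \<inter> good F2))) \<le> real (card F1) * (2 * p * real (card (good F2)))"
        using sum_mono[of F1, OF IH] by simp
      also have "\<dots> \<le> real D * (2 * p * real (card (good F2)))"
      proof -
        have "card F1 \<le> card {f \<in> E. J e \<inter> J f \<noteq> {}}"
          using E less.prems by (intro card_mono) (auto simp: F1_def)
        then show ?thesis
          using D[OF less.prems(3)] pD by (intro mult_right_mono) auto
      qed
      also have "\<dots> = (4 * p * real D) * (real (card (good F2)) / 2)"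
        by simp
      also have "\<dots> \<le> 1 * (real (card (good F2)) / 2)"
        using pD by (intro mult_right_mono) auto
      finally show ?thesis by simp
    qed
    have "real (card (B e \<inter> good F)) \<le> real (card (B e \<inter> good F2))"
      using fing F12(3) by (intro of_nat_mono card_mono) (auto simp: good_def)
    also note le2
    also have "p * real (card (good F2)) \<le> p * (2 * real (card (good F)))"
      using half pD by (intro mult_left_mono) auto
    finally show ?case by simp
  qed
  \<comment> \<open>Imposing the events one at a time keeps at least half of the points each time,
    so the good set never becomes empty.\<close>
  have "finite F \<Longrightarrow> F \<subseteq> E \<Longrightarrow> good F \<noteq> {}" for F
  proof (induction F rule: finite_induct)
    case empty
    then show ?case using pos by (auto simp: good_def card_gt_0_iff)
  next
    case (insert e F)
    have "real (card (B e \<inter> good F)) \<le> 2 * p * real (card (good F))"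
      using main insert by auto
    also have "\<dots> \<le> 1/2 * real (card (good F))"
      using p4 by (intro mult_right_mono) auto
    also have "\<dots> < real (card (good F))"
      using insert fing by (auto simp: card_gt_0_iff)
    finally have "card (B e \<inter> good F) < card (good F)" by simp
    then have "\<not> good F \<subseteq> B e"
      by (metis Int_absorb1 less_irrefl)
    then show ?case by (auto simp: good_def)
  qed
  from this[OF E order_refl] show ?thesis by (auto simp: good_def)
qed

lemma card_relpow_Image_le:
  fixes U :: "('a \<times> 'a) set"
  assumes "\<And>x. finite (U `` {x})" "\<And>x. card (U `` {x}) \<le> c"
  shows "finite ((U ^^ n) `` {x}) \<and> card ((U ^^ n) `` {x}) \<le> c ^ n"
proof (induction n)
  case (Suc n)
  have eq: "(U ^^ Suc n) `` {x} = (\<Union>y\<in>(U ^^ n) `` {x}. U `` {y})"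
    by auto
  have "card ((U ^^ Suc n) `` {x}) \<le> (\<Sum>y\<in>(U ^^ n) `` {x}. card (U `` {y}))"
    unfolding eq using Suc by (intro card_UN_le) auto
  also have "\<dots> \<le> card ((U ^^ n) `` {x}) * c"
    using sum_bounded_above[of "(U ^^ n) `` {x}" "\<lambda>y. card (U `` {y})" c] assms by simp
  also have "\<dots> \<le> c ^ n * c"
    using Suc by (intro mult_right_mono) auto
  finally show ?case
    unfolding eq using Suc assms by (auto simp: mult.commute)
qed auto

lemma converse_relpow:
  fixes U :: "('a \<times> 'a) set"
  shows "(U ^^ n)\<inverse> = U\<inverse> ^^ n"
proof (induction n)
  case (Suc n)
  then show ?case by (simp add: converse_relcomp relpow_commute)
qed auto

section \<open>List colourings with few conflicts per colour\<close>

text \<open>Lists are cut to length \<open>T = 16 * b\<close> and colours drawn uniformly. A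
  conflict has probability \<open>1 / T ^ 2\<close> and shares a vertex with at most
  \<open>4 * T * b\<close> conflicts, itself included; the value of \<open>T\<close> makes the
  condition of the local lemma an equality.\<close>

lemma list_coloring_bounded_conflicts:
  fixes V :: "'v set" and S :: "'v \<Rightarrow> 'c set" and E :: "'c \<Rightarrow> ('v \<times> 'v) set"
  assumes V: "finite V" and b: "1 \<le> b" and S: "\<And>v. v \<in> V \<Longrightarrow> 16 * b \<le> card (S v)"
    and E: "\<And>i. sym (E i)" "\<And>i. irrefl (E i)"
    and deg: "\<And>v i. v \<in> V \<Longrightarrow> card {u \<in> V. (v, u) \<in> E i} \<le> b"
  shows "\<exists>c. (\<forall>v \<in> V. c v \<in> S v) \<and> (\<forall>u \<in> V. \<forall>v \<in> V. (u, v) \<in> E (c u) \<longrightarrow> c u \<noteq> c v)"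
proof -
  define T where "T = 16 * b"
  have T: "0 < T" using b by (simp add: T_def)
  have "\<exists>S'. S' \<subseteq> S v \<and> card S' = T" if "v \<in> V" for v
    using S[OF that] obtain_subset_with_card_n[of T "S v"] unfolding T_def by metis
  then obtain S' where S': "\<And>v. v \<in> V \<Longrightarrow> S' v \<subseteq> S v" "\<And>v. v \<in> V \<Longrightarrow> card (S' v) = T"
    by metis
  have finS': "finite (S' v)" if "v \<in> V" for v
    using S'(2)[OF that] T by (intro card_ge_0_finite) auto
  \<comment> \<open>Each conflict occurs in both orientations, so one colour contributes up to
    \<open>2 * b\<close> events at a vertex.\<close>
  define Ev where "Ev = {(i, u, v). u \<in> V \<and> v \<in> V \<and> (u, v) \<in> E i \<and> i \<in> S' u \<and> i \<in> S' v}"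
  define B where "B = (\<lambda>(i, u, v). {x \<in> PiE V S'. x u = i \<and> x v = i})"
  define J where "J = (\<lambda>(i :: 'c, u, v). {u, v :: 'v})"
  have "Ev \<subseteq> (\<Union>v\<in>V. S' v) \<times> V \<times> V" by (auto simp: Ev_def)
  then have finE: "finite Ev" by (rule finite_subset) (use V finS' in auto)
  have "\<exists>x \<in> PiE V S'. \<forall>e \<in> Ev. x \<notin> B e"
  proof (rule lovasz_local_lemma[where J = J and p = "1 / real T ^ 2" and D = "4 * T * b"])
    show "y \<in> B e" if "e \<in> Ev" "x \<in> B e" "y \<in> PiE V S'" "\<And>j. j \<in> J e \<Longrightarrow> x j = y j" for e x y
      using that by (auto simp: B_def J_def)
    show "real (card (B e)) \<le> 1 / real T ^ 2 * real (card (PiE V S'))" if e: "e \<in> Ev" for e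
    proof -
      obtain i u v where e_eq: "e = (i, u, v)" by (cases e)
      have uv: "u \<in> V" "v \<in> V" "u \<noteq> v"
        using e E(2)[of i] by (auto simp: Ev_def e_eq irrefl_def)
      have "card {u, v} \<le> card V" using uv V by (intro card_mono) auto
      then have c2: "2 \<le> card V" using uv by simp
      \<comment> \<open>Fixing the colours of two distinct vertices leaves a product with two
        factors \<open>T\<close> fewer.\<close>
      have "B e \<subseteq> PiE V (\<lambda>w. if w \<in> {u, v} then {i} else S' w)"
        by (auto simp: B_def e_eq PiE_iff extensional_def)
      then have "card (B e) \<le> card (PiE V (\<lambda>w. if w \<in> {u, v} then {i} else S' w))"
        using V finS' by (intro card_mono finite_PiE) auto
      also have "\<dots> = (\<Prod>w\<in>V. if w \<in> {u, v} then 1 else T)"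
        unfolding card_PiE[OF V] using S' by (intro prod.cong) auto
      also have "\<dots> = T ^ card (V - {u, v})"
      proof -
        have "V \<inter> - {w. w \<in> {u, v}} = V - {u, v}" by auto
        then show ?thesis using V by (subst prod.If_cases) simp_all
      qed
      also have "card (V - {u, v}) = card V - 2"
        using uv V by (subst card_Diff_subset) auto
      finally have "T ^ 2 * card (B e) \<le> T ^ 2 * T ^ (card V - 2)" by simp
      also have "\<dots> = T ^ card V"
        using c2 by (simp only: power_add[symmetric] le_add_diff_inverse)
      also have "\<dots> = card (PiE V S')"
        using V S' by (simp add: card_PiE)
      finally have "real T ^ 2 * real (card (B e)) \<le> real (card (PiE V S'))"
        by (metis of_nat_le_iff of_nat_mult of_nat_power)
      then show ?thesis using T by (simp add: field_simps)
    qed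
    show "card {f \<in> Ev. J e \<inter> J f \<noteq> {}} \<le> 4 * T * b" if e: "e \<in> Ev" for e
    proof -
      obtain i u v where e_eq: "e = (i, u, v)" by (cases e)
      have uv: "u \<in> V" "v \<in> V" using e by (auto simp: Ev_def e_eq)
      define N where "N w j = {x \<in> V. (w, x) \<in> E j}" for w j
      define M where "M w j = (\<lambda>x. (j, w, x)) ` N w j \<union> (\<lambda>x. (j, x, w)) ` N w j" for w j
      have finN: "finite (N w j)" for w j using V by (simp add: N_def)
      have cM: "card (M w j) \<le> 2 * b" if "w \<in> V" for w j
      proof -
        have "card (M w j) \<le> card (N w j) + card (N w j)"
          unfolding M_def by (intro order_trans[OF card_Un_le] add_mono card_image_le finN)
        then show ?thesis using deg[OF that, of j] by (simp add: N_def)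
      qed
      have cw: "card (\<Union>j\<in>S' w. M w j) \<le> T * (2 * b)" if "w \<in> V" for w
      proof -
        have "card (\<Union>j\<in>S' w. M w j) \<le> (\<Sum>j\<in>S' w. card (M w j))"
          using finS' that by (intro card_UN_le) auto
        also have "\<dots> \<le> T * (2 * b)"
          using sum_bounded_above[of "S' w" "\<lambda>j. card (M w j)" "2 * b"] cM S' that by simp
        finally show ?thesis .
      qed
      have "{f \<in> Ev. J e \<inter> J f \<noteq> {}} \<subseteq> (\<Union>j\<in>S' u. M u j) \<union> (\<Union>j\<in>S' v. M v j)"
        using E(1) by (auto simp: Ev_def J_def e_eq M_def N_def sym_def)
      then have "card {f \<in> Ev. J e \<inter> J f \<noteq> {}} \<le> card ((\<Union>j\<in>S' u. M u j) \<union> (\<Union>j\<in>S' v. M v j))"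
        using finS' uv finN by (intro card_mono) (auto simp: M_def)
      also have "\<dots> \<le> T * (2 * b) + T * (2 * b)"
        using cw uv by (intro order_trans[OF card_Un_le] add_mono) auto
      finally show ?thesis by simp
    qed
    show "4 * (1 / (real T)\<^sup>2) * real (4 * T * b) \<le> 1"
      using T b by (simp add: power2_eq_square T_def)
    show "finite (S' i) \<and> S' i \<noteq> {}" if "i \<in> V" for i
      using finS'[OF that] S'(2)[OF that] T by auto
  qed (use V finE T b in \<open>auto simp: B_def\<close>)
  then obtain c where c: "c \<in> PiE V S'" "\<And>e. e \<in> Ev \<Longrightarrow> c \<notin> B e" by auto
  have "c u \<noteq> c v" if "u \<in> V" "v \<in> V" "(u, v) \<in> E (c u)" for u v
    using c(2)[of "(c u, u, v)"] c(1) that by (auto simp: Ev_def B_def PiE_iff)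
  moreover have "c v \<in> S v" if "v \<in> V" for v
    using c(1) S'(1)[OF that] that by (auto simp: PiE_iff)
  ultimately show ?thesis by blast
qed

section \<open>Levels of a graph with a good partition\<close>

text \<open>Since \<open>par r = r\<close>, iterating \<open>par\<close> beyond the depth of
  \<open>x\<close> stays at the root. So every ancestor is already reached within
  \<open>vheight r par x < h\<close> steps, and a proper one takes at least one step, which lowers
  the height.\<close>

lemma rooted_tree_ancestor:
  assumes T: "rooted_tree VT r par" "x \<in> VT" "tree_height VT r par < h"
    and y: "(par ^^ n) x = y" "x \<noteq> y"
  shows "vheight r par y < vheight r par x" "y \<in> (\<lambda>m. (par ^^ m) x) ` {..<h}"
proof -
  define m where "m = vheight r par x"
  have "\<exists>k. (par ^^ k) x = r"
    using T by (auto simp: rooted_tree_def)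
  then have m: "(par ^^ m) x = r"
    unfolding m_def vheight_def by (rule LeastI_ex)
  have fix_r: "(par ^^ k) r = r" for k
    using T by (induction k) (auto simp: rooted_tree_def)
  have "m \<le> tree_height VT r par"
    using T unfolding tree_height_def m_def rooted_tree_def by (intro Max_ge) auto
  then have mh: "m < h" using T by simp
  have "vheight r par y < m \<and> y \<in> (\<lambda>m. (par ^^ m) x) ` {..<h}"
  proof (cases "n < m")
    case True
    have "(par ^^ (m - n)) y = (par ^^ (m - n + n)) x"
      by (simp add: y(1)[symmetric] funpow_add)
    then have "(par ^^ (m - n)) y = r"
      using m True by simp
    then have "vheight r par y \<le> m - n"
      unfolding vheight_def by (rule Least_le)
    moreover have "n \<noteq> 0" using y by (cases n) auto
    ultimately show ?thesis using True mh y by auto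
  next
    case False
    have "(par ^^ n) x = (par ^^ (n - m + m)) x"
      using False by simp
    then have yr: "y = r"
      unfolding funpow_add using m fix_r y by simp
    then have "vheight r par y \<le> 0"
      unfolding vheight_def by (intro Least_le) simp
    moreover have "m \<noteq> 0" using m y yr by (cases m) auto
    ultimately show ?thesis using mh m yr by auto
  qed
  then show "vheight r par y < vheight r par x" "y \<in> (\<lambda>m. (par ^^ m) x) ` {..<h}"
    by (auto simp: m_def)
qed

text \<open>Guarantees that adjacent parts share one tree when a tree is chosen per
  component.\<close>

lemma component_edge_eq:
  assumes "sym (edges G)" "(x, y) \<in> edges G"
  shows "component G x = component G y"
proof -
  have "(y, x) \<in> edges G" using assms by (auto dest: symD)
  then have "(x, z) \<in> (edges G)\<^sup>* \<longleftrightarrow> (y, z) \<in> (edges G)\<^sup>*" for z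
    using assms(2) by (meson converse_rtrancl_into_rtrancl)
  then show ?thesis by (simp add: component_def)
qed

text \<open>Adjacent vertices in different parts have parts in ancestor relation, hence of different
  heights. So a neighbour on the same level lies in the same part, and a neighbour on a lower level
  lies in one of at most \<open>h\<close> ancestor parts.\<close>

lemma good_partition_graph_levels:
  assumes wf: "wf_graph G" and good: "good_partition_graph G t h" and h: "1 \<le> h"
  obtains lev :: "'v \<Rightarrow> nat" where
    "\<And>x. lev x < h"
    "\<And>x. card {y. (x, y) \<in> edges G \<and> lev y < lev x} \<le> h * nat \<lfloor>t\<rfloor>"
    "\<And>x. card {y. (x, y) \<in> edges G \<and> lev y = lev x} \<le> nat \<lfloor>t\<rfloor>"
proof -
  obtain P where P: "is_partition P (verts G)" "finite P" "\<And>U. U \<in> P \<Longrightarrow> real (card U) \<le> t"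
    and td: "\<And>A. A \<in> P \<Longrightarrow> treedepth_le (component (quotient_graph G P) A) h"
    using good by (auto simp: good_partition_graph_def)
  define Q where "Q = quotient_graph G P"
  have symG: "sym (edges G)" and EG: "edges G \<subseteq> verts G \<times> verts G" and finG: "finite (verts G)"
    using wf by (auto simp: wf_graph_def)
  have symQ: "sym (edges Q)"
    using symG by (auto simp: Q_def quotient_graph_def edges_def sym_def)
  have vQ: "verts Q = P" by (simp add: Q_def quotient_graph_def verts_def)
  have PU: "finite U" "U \<subseteq> verts G" "card U \<le> nat \<lfloor>t\<rfloor>" if "U \<in> P" for U
    using that P finG finite_subset[of U "verts G"] by (auto simp: is_partition_def intro: le_nat_floor)
  define W where "W C = (\<lambda>(VT, r, par). rooted_tree VT r par \<and> verts C \<subseteq> VT \<and> tree_height VT r par < h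
      \<and> (\<forall>(x, y) \<in> edges C. closure_adj par x y))" for C :: "'v set graph"
  \<comment> \<open>The tree is a function of the component alone, so the heights of adjacent parts
    are measured in the same tree.\<close>
  define tr where "tr C = (SOME x. W C x)" for C
  have W: "W (component Q A) (tr (component Q A))" if A: "A \<in> P" for A
  proof -
    obtain VT r par where "W (component Q A) (VT, r, par)"
      using td[OF A] h by (fastforce simp: treedepth_le_def W_def Q_def)
    then show ?thesis unfolding tr_def by (rule someI)
  qed
  define hgt where "hgt A = (case tr (component Q A) of (VT, r, par) \<Rightarrow> vheight r par A)" for A
  define anc where "anc A = (case tr (component Q A) of (VT, r, par) \<Rightarrow> (\<lambda>m. (par ^^ m) A) ` {..<h})" for A
  have hgt_less: "hgt A < h" if A: "A \<in> P" for A
  proof -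
    obtain VT r par where eq: "tr (component Q A) = (VT, r, par)" by (metis prod_cases3)
    have T: "rooted_tree VT r par" "tree_height VT r par < h" and sub: "verts (component Q A) \<subseteq> VT"
      using W[OF A] by (auto simp: W_def eq)
    have "A \<in> VT" using sub A vQ by (auto simp: component_def verts_def Let_def)
    then have "vheight r par A \<le> tree_height VT r par"
      using T unfolding tree_height_def rooted_tree_def by (intro Max_ge) auto
    then show ?thesis using T by (simp add: hgt_def eq)
  qed
  have card_anc: "card (anc A) \<le> h" "finite (anc A)" for A
    by (auto simp: anc_def intro: order_trans[OF card_image_le] split: prod.splits)
  have edge: "hgt A < hgt B \<and> A \<in> anc B \<or> hgt B < hgt A \<and> B \<in> anc A" if AB: "(A, B) \<in> edges Q" for A B
  proof -
    have mem: "A \<in> P" "B \<in> P" using AB by (auto simp: Q_def quotient_graph_def edges_def)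
    have comp: "component Q B = component Q A"
      using component_edge_eq[OF symQ AB] by simp
    obtain VT r par where eq: "tr (component Q A) = (VT, r, par)" by (metis prod_cases3)
    have T: "rooted_tree VT r par" "tree_height VT r par < h" and sub: "verts (component Q A) \<subseteq> VT"
      and cl: "\<forall>(x, y) \<in> edges (component Q A). closure_adj par x y"
      using W[OF mem(1)] by (auto simp: W_def eq)
    have V: "A \<in> VT" "B \<in> VT"
      using sub mem vQ AB by (auto simp: component_def verts_def Let_def)
    have "closure_adj par A B"
      using cl AB mem vQ by (auto simp: component_def edges_def verts_def Let_def)
    then obtain n where AB: "A \<noteq> B" and n: "(par ^^ n) A = B \<or> (par ^^ n) B = A"
      by (auto simp: closure_adj_def)
    from n show ?thesis
    proof
      assume "(par ^^ n) A = B"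
      from rooted_tree_ancestor[OF T(1) V(1) T(2) this AB] show ?thesis
        by (simp add: hgt_def anc_def comp eq)
    next
      assume "(par ^^ n) B = A"
      from rooted_tree_ancestor[OF T(1) V(2) T(2) this AB[symmetric]] show ?thesis
        by (simp add: hgt_def anc_def comp eq)
    qed
  qed
  define part where "part x = (SOME A. A \<in> P \<and> x \<in> A)" for x
  have part: "part x \<in> P" "x \<in> part x" if "x \<in> verts G" for x
  proof -
    have "\<exists>A. A \<in> P \<and> x \<in> A" using that P by (auto simp: is_partition_def)
    then have "part x \<in> P \<and> x \<in> part x" unfolding part_def by (rule someI_ex)
    then show "part x \<in> P" "x \<in> part x" by auto
  qed
  \<comment> \<open>Points outside the graph have no edges; the default 0 keeps
    \<open>lev x < h\<close> valid everywhere.\<close>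
  define lev where "lev x = (if x \<in> verts G then hgt (part x) else 0)" for x
  have E: "part y = part x \<or> lev x < lev y \<or> lev y < lev x \<and> part y \<in> anc (part x)"
    "x \<in> verts G" "y \<in> verts G"
    if xy: "(x, y) \<in> edges G" for x y
  proof -
    show mem: "x \<in> verts G" "y \<in> verts G" using xy EG by auto
    show "part y = part x \<or> lev x < lev y \<or> lev y < lev x \<and> part y \<in> anc (part x)"
    proof (cases "part y = part x")
      case False
      then have "(part x, part y) \<in> edges Q"
        using part[OF mem(1)] part[OF mem(2)] xy by (auto simp: Q_def quotient_graph_def edges_def)
      from edge[OF this] show ?thesis using mem by (auto simp: lev_def)
    qed simp
  qed
  show ?thesis
  proof (rule that[of lev])
    show "lev x < h" for x
      using hgt_less part h by (auto simp: lev_def)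
    show "card {y. (x, y) \<in> edges G \<and> lev y = lev x} \<le> nat \<lfloor>t\<rfloor>" for x
    proof (cases "x \<in> verts G")
      case True
      have "{y. (x, y) \<in> edges G \<and> lev y = lev x} \<subseteq> part x"
      proof
        fix y assume y: "y \<in> {y. (x, y) \<in> edges G \<and> lev y = lev x}"
        then have "part y = part x" using E(1)[of x y] by auto
        then show "y \<in> part x" using part(2)[OF E(3), of x y] y by auto
      qed
      then show ?thesis
        using card_mono[of "part x"] PU[OF part(1)[OF True]] by (meson order_trans)
    next
      case False
      then have "{y. (x, y) \<in> edges G \<and> lev y = lev x} = {}" using E(2) by blast
      then show ?thesis by (metis card.empty le0)
    qed
    show "card {y. (x, y) \<in> edges G \<and> lev y < lev x} \<le> h * nat \<lfloor>t\<rfloor>" for x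
    proof -
      have "{y. (x, y) \<in> edges G \<and> lev y < lev x} \<subseteq> \<Union>(anc (part x) \<inter> P)"
      proof
        fix y assume y: "y \<in> {y. (x, y) \<in> edges G \<and> lev y < lev x}"
        then have mem: "x \<in> verts G" "y \<in> verts G" using E by auto
        have "part y \<noteq> part x" using y mem by (auto simp: lev_def)
        then have "part y \<in> anc (part x)" using E(1)[of x y] y by auto
        then show "y \<in> \<Union>(anc (part x) \<inter> P)" using part[OF mem(2)] by auto
      qed
      then have "card {y. (x, y) \<in> edges G \<and> lev y < lev x} \<le> card (\<Union>(anc (part x) \<inter> P))"
        using P PU by (intro card_mono) auto
      also have "\<dots> \<le> sum card (anc (part x) \<inter> P)"
        by (rule card_Union_le_sum_card)
      also have "\<dots> \<le> card (anc (part x) \<inter> P) * nat \<lfloor>t\<rfloor>"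
        using sum_bounded_above[of "anc (part x) \<inter> P" card "nat \<lfloor>t\<rfloor>"] PU by simp
      also have "\<dots> \<le> h * nat \<lfloor>t\<rfloor>"
        using card_anc[of "part x"] card_mono[of "anc (part x)" "anc (part x) \<inter> P"]
        by (intro mult_right_mono) auto
      finally show ?thesis .
    qed
  qed
qed

section \<open>Random claims\<close>

locale claim_process =
  fixes V :: "'v set" and L :: "'v \<Rightarrow> nat set" and E :: "nat \<Rightarrow> ('v \<times> 'v) set"
    and lev :: "nat \<Rightarrow> 'v \<Rightarrow> nat" and h s T :: nat
  assumes V: "finite V" and L: "\<And>v. v \<in> V \<Longrightarrow> finite (L v)"
    and E: "\<And>u v i. (u, v) \<in> E i \<Longrightarrow> u \<in> V \<and> v \<in> V \<and> i \<in> L u \<and> i \<in> L v"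
    and lev: "\<And>i v. lev i v < h" and s: "0 < s"
begin

definition avail :: "('v \<Rightarrow> nat set) \<Rightarrow> nat \<Rightarrow> 'v \<Rightarrow> nat set" where
  "avail C n v = {i \<in> L v. lev i v = n \<and> (\<forall>u. (v, u) \<in> E i \<and> lev i u < n \<longrightarrow> i \<notin> C u)}"

text \<open>Segment \<open>k\<close> occupies the positions from \<open>k * s\<close> to
  \<open>k * s + s - 1\<close> of the sorted list. As the segments are disjoint, the picks are
  distinct, and a colour is picked by only one value of one coordinate.\<close>

definition picks :: "nat set \<Rightarrow> (nat \<Rightarrow> nat) \<Rightarrow> nat set" where
  "picks A x = (if s * T \<le> card A then (\<lambda>k. sorted_list_of_set A ! (k * s + x k)) ` {..<T} else {})"

text \<open>Stage \<open>n\<close> handles the colours on which the vertex has level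
  \<open>n\<close>; \<open>claimed X n\<close> collects the claims of all stages before
  \<open>n\<close>.\<close>

primrec claimed :: "('v \<times> nat \<times> nat \<Rightarrow> nat) \<Rightarrow> nat \<Rightarrow> 'v \<Rightarrow> nat set" where
  "claimed X 0 = (\<lambda>v. {})"
| "claimed X (Suc n) = 
     (\<lambda>v. claimed X n v \<union> picks (avail (claimed X n) n v) (\<lambda>k. X (v, n, k)))"

abbreviation av where "av X n \<equiv> avail (claimed X n) n"

text \<open>Coordinate \<open>(v, n, k)\<close> is the offset of \<open>v\<close> in segment
  \<open>k\<close> at stage \<open>n\<close>. It is present even if \<open>v\<close> claims nothing
  at that stage, which makes the space a product.\<close>

abbreviation choices :: "('v \<times> nat \<times> nat \<Rightarrow> nat) set" where
  "choices \<equiv> PiE (V \<times> {..<h} \<times> {..<T}) (\<lambda>_. {..<s})"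

definition claim_at where
  "claim_at X v m k i \<longleftrightarrow> k < T \<and> s * T \<le> card (av X m v) \<and>
     i = sorted_list_of_set (av X m v) ! (k * s + X (v, m, k))"

lemma claimed_iff: "i \<in> claimed X n v \<longleftrightarrow> (\<exists>m<n. \<exists>k. claim_at X v m k i)"
proof (induction n)
  case (Suc n)
  have "i \<in> claimed X (Suc n) v \<longleftrightarrow> i \<in> claimed X n v \<or> (\<exists>k. claim_at X v n k i)"
    by (auto simp: claim_at_def picks_def)
  then show ?case using Suc by (auto simp: less_Suc_eq)
qed simp

lemma choices_less: "X \<in> choices \<Longrightarrow> v \<in> V \<Longrightarrow> m < h \<Longrightarrow> k < T \<Longrightarrow> X (v, m, k) < s"
  by (auto simp: PiE_iff)

lemma finite_avail: "v \<in> V \<Longrightarrow> finite (avail C n v)"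
  using L by (auto simp: avail_def)

lemma index_less:
  assumes "X \<in> choices" "v \<in> V" "m < h" "k < T"
  shows "k * s + X (v, m, k) < s * T"
proof -
  have "k * s + X (v, m, k) < (k + 1) * s"
    using choices_less[OF assms] by simp
  also have "\<dots> \<le> T * s"
    using assms by (intro mult_right_mono) auto
  finally show ?thesis by (simp add: mult.commute)
qed

lemma claim_at_avail:
  assumes X: "X \<in> choices" "v \<in> V" "m < h" and c: "claim_at X v m k i"
  shows "i \<in> av X m v"
proof -
  have "k * s + X (v, m, k) < card (av X m v)"
    using index_less[of X v m k] assms by (auto simp: claim_at_def)
  then have "i \<in> set (sorted_list_of_set (av X m v))"
    using c unfolding claim_at_def by (metis nth_mem length_sorted_list_of_set)
  then show ?thesis using finite_avail[OF X(2)] by simp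
qed

text \<open>Colours available at stage \<open>m\<close> have level \<open>m\<close> at the vertex,
  so \<open>v\<close> can claim \<open>i\<close> only at stage \<open>lev i v\<close>.\<close>

lemma claimedD:
  assumes "X \<in> choices" "v \<in> V" "i \<in> claimed X h v"
  shows "i \<in> L v" "i \<in> av X (lev i v) v" "\<exists>k. claim_at X v (lev i v) k i"
proof -
  obtain m k where m: "m < h" "claim_at X v m k i"
    using assms(3) by (auto simp: claimed_iff)
  then have "i \<in> av X m v" using assms claim_at_avail by blast
  moreover from this have "lev i v = m" by (simp add: avail_def)
  ultimately show "i \<in> L v" "i \<in> av X (lev i v) v" "\<exists>k. claim_at X v (lev i v) k i"
    using m by (auto simp: avail_def)
qed

lemma claimed_level_mono: "n \<le> m \<Longrightarrow> claimed X n v \<subseteq> claimed X m v"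
  by (meson claimed_iff order_less_le_trans subsetI)

lemma claimed_conflict_same_level:
  assumes X: "X \<in> choices" and sym: "sym (E i)" and uv: "(u, v) \<in> E i"
    and c: "i \<in> claimed X h u" "i \<in> claimed X h v"
  shows "lev i u = lev i v"
proof -
  have *: "\<not> lev i x < lev i y" if xy: "(y, x) \<in> E i" "i \<in> claimed X h x" "i \<in> claimed X h y" for x y
  proof
    assume less: "lev i x < lev i y"
    have mem: "x \<in> V" "y \<in> V" using E xy by auto
    have "i \<in> claimed X (lev i y) x"
      using claimedD(3)[OF X mem(1) xy(2)] less by (auto simp: claimed_iff)
    moreover have "i \<in> av X (lev i y) y"
      using claimedD(2)[OF X mem(2) xy(3)] .
    ultimately show False using xy(1) less by (auto simp: avail_def)
  qed
  have "(v, u) \<in> E i" using sym uv by (auto dest: symD)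
  then show ?thesis using *[of v u] *[of u v] uv c by auto
qed

text \<open>Division by \<open>s\<close> recovers the segment from a position, so the
  \<open>T\<close> picks of one stage are distinct.\<close>

lemma card_claimed_ge:
  assumes X: "X \<in> choices" "v \<in> V" "m < h" and c: "s * T \<le> card (av X m v)"
  shows "T \<le> card (claimed X h v)"
proof -
  let ?f = "\<lambda>k. sorted_list_of_set (av X m v) ! (k * s + X (v, m, k))"
  have "inj_on ?f {..<T}"
  proof (rule inj_onI)
    fix k k' assume k: "k \<in> {..<T}" "k' \<in> {..<T}" "?f k = ?f k'"
    then have eq: "k * s + X (v, m, k) = k' * s + X (v, m, k')"
      using index_less[OF X, of k] index_less[OF X, of k'] c
      by (subst (asm) nth_eq_iff_index_eq) auto
    have d: "(k * s + X (v, m, k)) div s = k" "(k' * s + X (v, m, k')) div s = k'"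
      using choices_less[OF X, of k] choices_less[OF X, of k'] k s by auto
    show "k = k'"
      using d(1)[unfolded eq] d(2) by (rule trans[OF sym])
  qed
  then have "T = card (?f ` {..<T})" by (simp add: card_image)
  also have "\<dots> \<le> card (claimed X h v)"
  proof (rule card_mono)
    show "finite (claimed X h v)"
      using claimedD(1)[OF X(1,2)] L[OF X(2)] by (meson finite_subset subsetI)
    have "claim_at X v m k (?f k)" if "k < T" for k
      using c that by (simp add: claim_at_def)
    then have "?f k \<in> claimed X h v" if "k < T" for k
      unfolding claimed_iff using X(3) that by blast
    then show "?f ` {..<T} \<subseteq> claimed X h v" by auto
  qed
  finally show ?thesis .
qed

section \<open>Dependence of the claims on the random choices\<close>

text \<open>Steps to lower-level neighbours in the graphs of all colours together. Levels belong to
  single graphs, so \<open>up\<close> may contain cycles; the number of stages, not the level,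
  bounds the length of a dependency.\<close>

definition up :: "('v \<times> 'v) set" where
  "up = {(v, u). \<exists>i. (v, u) \<in> E i \<and> lev i u < lev i v}"

text \<open>A stage inspects only earlier claims of lower-level neighbours, so each stage after the
  first lengthens the dependency by one step of \<open>up\<close>. The first stage inspects nobody,
  hence \<open>h\<close> stages reach only \<open>h - 1\<close> steps; this is the source of
  \<open>h - 1\<close> in the final bound. The reflexive closure turns exactly \<open>n\<close>
  steps into at most \<open>n\<close>.\<close>

lemma claimed_cong:
  assumes "\<And>w m k. (v, w) \<in> (up\<^sup>=) ^^ n \<Longrightarrow> X (w, m, k) = Y (w, m, k)"
  shows "claimed X (Suc n) v = claimed Y (Suc n) v"
  using assms
proof (induction n arbitrary: v)
  case 0
  then have "X (v, 0, k) = Y (v, 0, k)" for k by simp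
  then show ?case by simp
next
  case (Suc n)
  have sub: "(v, w) \<in> (up\<^sup>=) ^^ Suc n" if "(u, w) \<in> (up\<^sup>=) ^^ n" "(v, u) \<in> up\<^sup>=" for u w
    using that by (meson relpow_Suc_I2)
  have 1: "claimed X (Suc n) u = claimed Y (Suc n) u" if "(v, u) \<in> up\<^sup>=" for u
    by (rule Suc.IH, rule Suc.prems, rule sub[OF _ that])
  have 2: "av X (Suc n) v = av Y (Suc n) v"
  proof -
    have "i \<in> claimed X (Suc n) u \<longleftrightarrow> i \<in> claimed Y (Suc n) u"
      if "(v, u) \<in> E i" "lev i u < Suc n" "lev i v = Suc n" for u i
    proof -
      have "(v, u) \<in> up\<^sup>=" using that unfolding up_def by auto
      then show ?thesis using 1 by blast
    qed
    then show ?thesis unfolding avail_def by blast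
  qed
  have "(v, v) \<in> (up\<^sup>=) ^^ Suc n"
    by (rule relpow_fun_conv[THEN iffD2]) (rule exI[of _ "\<lambda>_. v"], simp)
  then have 3: "X (v, m, k) = Y (v, m, k)" for m k
    by (rule Suc.prems)
  show ?case
    unfolding claimed.simps(2)[of _ "Suc n"] 2 3 using 1[of v] by simp
qed

lemma claimed_cong_below:
  assumes "\<And>w m k. m < n \<Longrightarrow> X (w, m, k) = Y (w, m, k)"
  shows "claimed X n = claimed Y n"
  using assms
proof (induction n)
  case (Suc n)
  then have "claimed X n = claimed Y n" by auto
  moreover have "X (w, n, k) = Y (w, n, k)" for w k
    by (rule Suc.prems) simp
  ultimately show ?case by simp
qed simp

text \<open>The sorted list has no repetition, so a colour determines its position, which division
  by \<open>s\<close> with remainder splits into segment and offset.\<close>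

lemma claim_at_unique:
  assumes X: "X \<in> choices" "Y \<in> choices" "v \<in> V" "m < h" and eq: "av X m v = av Y m v"
    and c: "claim_at X v m k i" "claim_at Y v m k' i"
  shows "k = k'" "X (v, m, k) = Y (v, m, k')"
proof -
  have kT: "k < T" "k' < T" using c by (auto simp: claim_at_def)
  have "k * s + X (v, m, k) = k' * s + Y (v, m, k')"
  proof (rule nth_eq_iff_index_eq[THEN iffD1])
    show "distinct (sorted_list_of_set (av X m v))" by simp
    show "sorted_list_of_set (av X m v) ! (k * s + X (v, m, k)) =
        sorted_list_of_set (av X m v) ! (k' * s + Y (v, m, k'))"
      using c eq by (simp add: claim_at_def)
  qed (use index_less[OF X(1,3,4) kT(1)] index_less[OF X(2,3,4) kT(2)] c eq in \<open>auto simp: claim_at_def\<close>)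
  moreover have "X (v, m, k) < s" "Y (v, m, k') < s"
    using X kT choices_less by auto
  moreover from this have "(k * s + X (v, m, k)) div s = k" "(k' * s + Y (v, m, k')) div s = k'"
    by auto
  ultimately show "k = k'" by simp
  then show "X (v, m, k) = Y (v, m, k')"
    using \<open>k * s + X (v, m, k) = k' * s + Y (v, m, k')\<close> by simp
qed

section \<open>Probability that a vertex claims too few colours\<close>

text \<open>Rewriting the coordinate responsible for each claim in \<open>Q\<close> by an arbitrary value loses no
  information: level by level, the claims themselves tell which coordinate was rewritten and what
  its value was.\<close>

lemma card_choices_with_claims_le:
  assumes Q: "finite Q" "fst ` Q \<subseteq> V"
  shows "card {X \<in> choices. \<forall>(u, i) \<in> Q. i \<in> claimed X h u} * s ^ card Q \<le> card choices"
proof -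
  define F where "F = {X \<in> choices. \<forall>(u, i) \<in> Q. i \<in> claimed X h u}"
  define slot where "slot X = (\<lambda>(u, i). SOME k. claim_at X u (lev i u) k i)" for X
  define key where "key X q = (fst q, lev (snd q) (fst q), slot X q)" for X q
  have F: "X \<in> choices" if "X \<in> F" for X
    using that by (simp add: F_def)
  have slot: "claim_at X u (lev i u) (slot X (u, i)) i" if "X \<in> F" "(u, i) \<in> Q" for X u i
  proof -
    have "i \<in> claimed X h u" "u \<in> V" using that Q by (auto simp: F_def)
    then show ?thesis using claimedD(3)[OF F[OF that(1)]] unfolding slot_def by (auto intro: someI_ex)
  qed
  \<comment> \<open>One coordinate yields one colour, so different claims in \<open>Q\<close> occupy
    different coordinates and can be rewritten independently.\<close>
  have key_inj: "inj_on (key X) Q" if X: "X \<in> F" for X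
  proof (rule inj_onI)
    fix q q' assume q: "q \<in> Q" "q' \<in> Q" "key X q = key X q'"
    obtain u i u' i' where qq: "q = (u, i)" "q' = (u', i')" by fastforce
    have "u = u' \<and> lev i u = lev i' u' \<and> slot X (u, i) = slot X (u', i')"
      using q(3) unfolding key_def qq prod.inject fst_conv snd_conv .
    moreover from this have "i = i'"
      using slot[OF X, of u i] slot[OF X, of u' i'] q(1,2) unfolding claim_at_def qq by metis
    ultimately show "q = q'" by (simp add: qq)
  qed
  define rewrite where "rewrite = (\<lambda>(X, g) z. if z \<in> key X ` Q then g (inv_into Q (key X) z) else X z)"
  have rewrite_key: "rewrite (X, g) (key X q) = g q" if "X \<in> F" "q \<in> Q" for X g q
    using that key_inj by (auto simp: rewrite_def)
  have key_mem: "key X q \<in> V \<times> {..<h} \<times> {..<T}" if "X \<in> F" "q \<in> Q" for X q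
    using slot[OF that(1), of "fst q" "snd q"] that Q lev by (auto simp: key_def claim_at_def)
  have "rewrite ` (F \<times> PiE Q (\<lambda>_. {..<s})) \<subseteq> choices"
  proof clarify
    fix X g assume Xg: "X \<in> F" "g \<in> PiE Q (\<lambda>_. {..<s})"
    have "rewrite (X, g) z < s" if "z \<in> V \<times> {..<h} \<times> {..<T}" for z
    proof (cases "z \<in> key X ` Q")
      case True
      then obtain q where "q \<in> Q" "z = key X q" by blast
      then show ?thesis using rewrite_key[OF Xg(1)] Xg(2) by (auto simp: PiE_iff)
    next
      case False
      then show ?thesis using PiE_mem[OF F[OF Xg(1)] that] by (simp add: rewrite_def)
    qed
    moreover have "rewrite (X, g) z = undefined" if "z \<notin> V \<times> {..<h} \<times> {..<T}" for z
      using PiE_arb[OF F[OF Xg(1)] that] key_mem[OF Xg(1)] that by (auto simp: rewrite_def)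
    ultimately show "rewrite (X, g) \<in> choices"
      by (intro PiE_I) auto
  qed
  moreover have "inj_on rewrite (F \<times> PiE Q (\<lambda>_. {..<s}))"
  proof (rule inj_onI, clarify)
    fix X g Y g' assume X: "X \<in> F" and Y: "Y \<in> F"
      and g: "g \<in> PiE Q (\<lambda>_. {..<s})" "g' \<in> PiE Q (\<lambda>_. {..<s})"
      and eq: "rewrite (X, g) = rewrite (Y, g')"
    \<comment> \<open>Once all coordinates of stages before \<open>n\<close> agree, so do the
      available colours at stage \<open>n\<close>. The claims in \<open>Q\<close> of level
      \<open>n\<close> then have the same coordinates and values in \<open>X\<close> and
      \<open>Y\<close>, and the other coordinates of this stage were not rewritten.\<close>
    have agree: "\<forall>w m k. m < n \<longrightarrow> X (w, m, k) = Y (w, m, k)" for n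
    proof (induction n)
      case (Suc n)
      then have "claimed X n = claimed Y n" by (intro claimed_cong_below) auto
      then have av: "av X n u = av Y n u" for u by simp
      have key_eq: "key X q = key Y q \<and> X (key X q) = Y (key X q)"
        if q: "q \<in> Q" "lev (snd q) (fst q) = n" for q
      proof -
        obtain u i where qq: "q = (u, i)" by (cases q)
        have "u \<in> V" "n < h" using q Q lev[of i u] by (auto simp: qq)
        note unique = claim_at_unique[OF F[OF X] F[OF Y] this av]
        have "claim_at X u n (slot X (u, i)) i" "claim_at Y u n (slot Y (u, i)) i"
          using slot[OF X, of u i] slot[OF Y, of u i] q by (auto simp: qq)
        from unique[OF this] show ?thesis using q by (simp add: key_def qq)
      qed
      have "X (w, n, k) = Y (w, n, k)" for w k
      proof (cases "(w, n, k) \<in> key X ` Q \<union> key Y ` Q")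
        case True
        then obtain q where q: "q \<in> Q" "(w, n, k) = key X q \<or> (w, n, k) = key Y q" by blast
        then have "lev (snd q) (fst q) = n" by (auto simp: key_def)
        from key_eq[OF q(1) this] show ?thesis using q(2) by metis
      next
        case False
        then show ?thesis using fun_cong[OF eq, of "(w, n, k)"] by (simp add: rewrite_def)
      qed
      then show ?case using Suc by (auto simp: less_Suc_eq)
    qed simp
    have "X = Y"
    proof
      fix z show "X z = Y z"
        using agree by (metis prod_cases3 lessI)
    qed
    moreover have "g = g'"
    proof (rule PiE_ext[OF g])
      fix q assume "q \<in> Q"
      then show "g q = g' q"
        using rewrite_key[OF X] eq \<open>X = Y\<close> by metis
    qed
    ultimately show "X = Y \<and> g = g'" by simp
  qed
  moreover have "finite choices" using V by (intro finite_PiE) auto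
  ultimately have "card (F \<times> PiE Q (\<lambda>_. {..<s})) \<le> card choices"
    by (metis card_inj_on_le)
  then show ?thesis using Q by (simp add: F_def card_cartesian_product card_PiE)
qed

text \<open>If \<open>v\<close> claims fewer than \<open>T\<close> colours, no stage offered it
  \<open>s * T\<close> colours, so at least \<open>r\<close> colours of its list are claimed by
  lower-level neighbours. The union bound runs over at most \<open>2 ^ l\<close> sets of
  \<open>r\<close> colours and \<open>a ^ r\<close> assignments of claimants, each realized with
  probability at most \<open>1 / s ^ r\<close>.\<close>

lemma card_few_claims_le:
  assumes v: "v \<in> V" and cardL: "card (L v) = l" and r: "r + h * (s * T) \<le> l"
    and up: "\<And>i. card {u. (v, u) \<in> E i \<and> lev i u < lev i v} \<le> a"
  shows "card {X \<in> choices. card (claimed X h v) < T} * s ^ r \<le> 2 ^ l * a ^ r * card choices"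
proof -
  define N where "N i = {u. (v, u) \<in> E i \<and> lev i u < lev i v}" for i
  define FF where "FF K = PiE K N" for K
  \<comment> \<open>The pairs differ in their colours, so there are \<open>r\<close> of them even if
    one neighbour claims several.\<close>
  define Q where "Q K f = (\<lambda>i. (f i, i)) ` K" for K :: "nat set" and f :: "nat \<Rightarrow> 'v"
  define Cl where "Cl q = {X \<in> choices. \<forall>(u, i) \<in> q. i \<in> claimed X h u}" for q
  define KK where "KK = {K. K \<subseteq> L v \<and> card K = r}"
  have finc: "finite choices" using V by (intro finite_PiE) auto
  have finN: "finite (N i)" for i
    using E by (intro finite_subset[OF _ V]) (auto simp: N_def)
  have KKsub: "KK \<subseteq> Pow (L v)" by (auto simp: KK_def)
  have finKK: "finite KK" using KKsub L[OF v] by (meson finite_Pow_iff finite_subset)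
  have finK: "finite K" if "K \<in> KK" for K
    using that L[OF v] by (auto simp: KK_def intro: finite_subset)
  have finFF: "finite (FF K)" if "K \<in> KK" for K
    unfolding FF_def using finK[OF that] finN by (intro finite_PiE) auto
  have cover: "{X \<in> choices. card (claimed X h v) < T} \<subseteq> (\<Union>K\<in>KK. \<Union>f\<in>FF K. Cl (Q K f))"
  proof
    fix X assume "X \<in> {X \<in> choices. card (claimed X h v) < T}"
    then have X: "X \<in> choices" "card (claimed X h v) < T" by auto
    \<comment> \<open>Claims are inspected at the end rather than at the turn of \<open>v\<close>.
      As claims only accumulate, every colour outside \<open>K0\<close> was available at its
      stage.\<close>
    define K0 where "K0 = {i \<in> L v. \<exists>u. u \<in> N i \<and> i \<in> claimed X h u}"
    have "L v - K0 \<subseteq> (\<Union>m<h. av X m v)"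
    proof
      fix i assume i: "i \<in> L v - K0"
      have "i \<notin> claimed X (lev i v) u" if "u \<in> N i" for u
        using i that claimed_level_mono[of "lev i v" h X u] lev[of i v] by (auto simp: K0_def)
      then have "i \<in> av X (lev i v) v"
        using i by (auto simp: avail_def N_def)
      then show "i \<in> (\<Union>m<h. av X m v)" using lev by blast
    qed
    then have "card (L v - K0) \<le> card (\<Union>m<h. av X m v)"
      using finite_avail[OF v] by (intro card_mono) auto
    also have "\<dots> \<le> (\<Sum>m<h. card (av X m v))"
      by (intro card_UN_le) auto
    also have "\<dots> \<le> card {..<h} * (s * T)"
    proof (rule sum_bounded_above[of _ _ "s * T", simplified of_nat_id])
      fix m assume "m \<in> {..<h}"
      then show "card (av X m v) \<le> s * T"
        using card_claimed_ge[OF X(1) v, of m] X(2)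
        by (cases "s * T \<le> card (av X m v)") auto
    qed
    finally have "card (L v - K0) \<le> h * (s * T)" by simp
    moreover have "card (L v - K0) = l - card K0"
      using L[OF v] cardL by (subst card_Diff_subset) (auto simp: K0_def intro: finite_subset)
    ultimately have "r \<le> card K0" using r by simp
    then obtain K where K: "K \<subseteq> K0" "card K = r" by (meson obtain_subset_with_card_n)
    define f where "f = (\<lambda>i\<in>K. SOME u. u \<in> N i \<and> i \<in> claimed X h u)"
    have f: "f i \<in> N i \<and> i \<in> claimed X h (f i)" if "i \<in> K" for i
    proof -
      have "\<exists>u. u \<in> N i \<and> i \<in> claimed X h u" using that K by (auto simp: K0_def)
      from someI_ex[OF this] show ?thesis unfolding f_def using that by simp
    qed
    have "K \<in> KK" using K by (auto simp: KK_def K0_def)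
    moreover have "f \<in> FF K" using f by (auto simp: FF_def f_def)
    moreover have "X \<in> Cl (Q K f)" using f X by (auto simp: Cl_def Q_def)
    ultimately show "X \<in> (\<Union>K\<in>KK. \<Union>f\<in>FF K. Cl (Q K f))" by blast
  qed
  have each: "card (Cl (Q K f)) * s ^ r \<le> card choices" if "K \<in> KK" "f \<in> FF K" for K f
  proof -
    have "fst ` Q K f \<subseteq> V"
      using that E by (auto simp: Q_def FF_def N_def PiE_iff)
    moreover have "card (Q K f) = r"
      unfolding Q_def using that by (subst card_image) (auto simp: inj_on_def KK_def)
    moreover have "finite (Q K f)" using finK[OF that(1)] by (simp add: Q_def)
    ultimately show ?thesis using card_choices_with_claims_le[of "Q K f"] by (simp add: Cl_def)
  qed
  have cardFF: "card (FF K) \<le> a ^ r" if "K \<in> KK" for K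
  proof -
    have "card (FF K) = (\<Prod>i\<in>K. card (N i))"
      unfolding FF_def by (rule card_PiE[OF finK[OF that]])
    also have "\<dots> \<le> (\<Prod>i\<in>K. a)"
      using up by (intro prod_mono) (auto simp: N_def)
    finally show ?thesis using that by (simp add: KK_def)
  qed
  have cardKK: "card KK \<le> 2 ^ l"
    using card_mono[OF _ KKsub] L[OF v] cardL by (simp add: card_Pow)
  have "card {X \<in> choices. card (claimed X h v) < T} \<le> card (\<Union>K\<in>KK. \<Union>f\<in>FF K. Cl (Q K f))"
    using finc finKK finFF by (intro card_mono[OF _ cover]) (auto simp: Cl_def)
  also have "\<dots> \<le> (\<Sum>K\<in>KK. card (\<Union>f\<in>FF K. Cl (Q K f)))"
    by (rule card_UN_le[OF finKK])
  also have "\<dots> \<le> (\<Sum>K\<in>KK. \<Sum>f\<in>FF K. card (Cl (Q K f)))"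
    by (intro sum_mono card_UN_le finFF)
  finally have "card {X \<in> choices. card (claimed X h v) < T} * s ^ r
      \<le> (\<Sum>K\<in>KK. \<Sum>f\<in>FF K. card (Cl (Q K f))) * s ^ r"
    by (rule mult_right_mono) simp
  also have "\<dots> = (\<Sum>K\<in>KK. \<Sum>f\<in>FF K. card (Cl (Q K f)) * s ^ r)"
    by (simp add: sum_distrib_right)
  also have "\<dots> \<le> (\<Sum>K\<in>KK. \<Sum>f\<in>FF K. card choices)"
    by (intro sum_mono each)
  also have "\<dots> \<le> (\<Sum>K\<in>KK. a ^ r * card choices)"
    using cardFF by (intro sum_mono) (simp add: mult_right_mono)
  also have "\<dots> \<le> 2 ^ l * a ^ r * card choices"
    using cardKK by (simp add: mult_right_mono mult.assoc)
  finally show ?thesis .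
qed

section \<open>The local lemma for the claims\<close>

lemma card_up_Image:
  assumes cardL: "\<And>v. v \<in> V \<Longrightarrow> card (L v) = l"
    and up: "\<And>v i. card {u. (v, u) \<in> E i \<and> lev i u < lev i v} \<le> a"
  shows "finite (up\<^sup>= `` {v}) \<and> card (up\<^sup>= `` {v}) \<le> 1 + l * a"
proof (cases "v \<in> V")
  case True
  define N where "N i = {u. (v, u) \<in> E i \<and> lev i u < lev i v}" for i
  have finN: "finite (N i)" for i
    using E by (intro finite_subset[OF _ V]) (auto simp: N_def)
  have sub: "up\<^sup>= `` {v} \<subseteq> insert v (\<Union>i\<in>L v. N i)"
    using E by (auto simp: up_def N_def)
  have fin: "finite (insert v (\<Union>i\<in>L v. N i))" using L[OF True] finN by auto
  have "card (insert v (\<Union>i\<in>L v. N i)) \<le> Suc (card (\<Union>i\<in>L v. N i))"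
    using L[OF True] finN by (simp add: card_insert_if)
  also have "card (\<Union>i\<in>L v. N i) \<le> (\<Sum>i\<in>L v. card (N i))"
    by (rule card_UN_le[OF L[OF True]])
  also have "\<dots> \<le> l * a"
    using sum_bounded_above[of "L v" "\<lambda>i. card (N i)" a] up cardL[OF True] by (simp add: N_def)
  finally show ?thesis
    using card_mono[OF fin sub] finite_subset[OF sub fin] by simp
next
  case False
  then have "up\<^sup>= `` {v} = {v}" using E by (auto simp: up_def)
  then show ?thesis by simp
qed

text \<open>A step of \<open>up\<close> costs only \<open>a\<close> per colour, but a step back can
  cost the full degree: a vertex may have the lower level towards all its neighbours.\<close>

lemma card_down_Image:
  assumes cardL: "\<And>v. v \<in> V \<Longrightarrow> card (L v) = l"
    and deg: "\<And>v i. card {u. (u, v) \<in> E i} \<le> d"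
  shows "finite ((up\<^sup>=)\<inverse> `` {v}) \<and> card ((up\<^sup>=)\<inverse> `` {v}) \<le> 1 + l * d"
proof (cases "v \<in> V")
  case True
  define N where "N i = {u. (u, v) \<in> E i}" for i
  have finN: "finite (N i)" for i
    using E by (intro finite_subset[OF _ V]) (auto simp: N_def)
  have sub: "(up\<^sup>=)\<inverse> `` {v} \<subseteq> insert v (\<Union>i\<in>L v. N i)"
    using E by (auto simp: up_def N_def)
  have fin: "finite (insert v (\<Union>i\<in>L v. N i))" using L[OF True] finN by auto
  have "card (insert v (\<Union>i\<in>L v. N i)) \<le> Suc (card (\<Union>i\<in>L v. N i))"
    using L[OF True] finN by (simp add: card_insert_if)
  also have "card (\<Union>i\<in>L v. N i) \<le> (\<Sum>i\<in>L v. card (N i))"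
    by (rule card_UN_le[OF L[OF True]])
  also have "\<dots> \<le> l * d"
    using sum_bounded_above[of "L v" "\<lambda>i. card (N i)" d] deg cardL[OF True] by (simp add: N_def)
  finally show ?thesis
    using card_mono[OF fin sub] finite_subset[OF sub fin] by simp
next
  case False
  then have "(up\<^sup>=)\<inverse> `` {v} = {v}" using E by (auto simp: up_def)
  then show ?thesis by simp
qed

text \<open>Events of \<open>v\<close> and \<open>w\<close> share coordinates only if some vertex is
  reachable from both, so \<open>w\<close> is found by \<open>h - 1\<close> steps of
  \<open>up\<close> followed by \<open>h - 1\<close> steps back. Only the way back involves
  \<open>d\<close>.\<close>

lemma exists_all_claiming:
  assumes cardL: "\<And>v. v \<in> V \<Longrightarrow> card (L v) = l" and r: "r + h * (s * T) \<le> l"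
    and up: "\<And>v i. card {u. (v, u) \<in> E i \<and> lev i u < lev i v} \<le> a"
    and deg: "\<And>v i. card {u. (u, v) \<in> E i} \<le> d"
    and h: "1 \<le> h"
    and small: "4 * 2 ^ l * a ^ r * ((1 + l * a) * (1 + l * d)) ^ (h - 1) \<le> s ^ r"
  shows "\<exists>X \<in> choices. \<forall>v \<in> V. T \<le> card (claimed X h v)"
proof -
  define reach where "reach v = ((up\<^sup>=) ^^ (h - 1)) `` {v}" for v
  define coreach where "coreach v = (((up\<^sup>=)\<inverse>) ^^ (h - 1)) `` {v}" for v
  have reach: "finite (reach v) \<and> card (reach v) \<le> (1 + l * a) ^ (h - 1)" for v
    unfolding reach_def using card_up_Image[OF cardL up] by (intro card_relpow_Image_le) auto
  have coreach: "finite (coreach v) \<and> card (coreach v) \<le> (1 + l * d) ^ (h - 1)" for v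
    unfolding coreach_def using card_down_Image[OF cardL deg] by (intro card_relpow_Image_le) auto
  define J where "J v = reach v \<times> (UNIV :: (nat \<times> nat) set)" for v
  define B where "B v = {X \<in> choices. card (claimed X h v) < T}" for v
  define p where "p = 2 ^ l * real a ^ r / real s ^ r"
  have "\<exists>X \<in> choices. \<forall>v \<in> V. X \<notin> B v"
  proof (rule lovasz_local_lemma[where J = J and p = p and D = "((1 + l * a) * (1 + l * d)) ^ (h - 1)"])
    show "real (card (B v)) \<le> p * real (card choices)" if "v \<in> V" for v
    proof -
      have "card (B v) * s ^ r \<le> 2 ^ l * a ^ r * card choices"
        unfolding B_def by (rule card_few_claims_le[OF that cardL[OF that] r up])
      then have "real (card (B v) * s ^ r) \<le> real (2 ^ l * a ^ r * card choices)"
        by (rule of_nat_mono)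
      then have "real (card (B v)) * real s ^ r \<le> 2 ^ l * real a ^ r * real (card choices)"
        by (simp only: of_nat_mult of_nat_power of_nat_numeral)
      then show ?thesis
        unfolding p_def times_divide_eq_left using s by (subst pos_le_divide_eq) auto
    qed
    show "Y \<in> B v" if "v \<in> V" "X \<in> B v" "Y \<in> choices" "\<And>j. j \<in> J v \<Longrightarrow> X j = Y j" for v X Y
    proof -
      have "claimed X (Suc (h - 1)) v = claimed Y (Suc (h - 1)) v"
        using that(4) by (intro claimed_cong) (auto simp: J_def reach_def)
      then show ?thesis using that h by (simp add: B_def)
    qed
    show "card {w \<in> V. J v \<inter> J w \<noteq> {}} \<le> ((1 + l * a) * (1 + l * d)) ^ (h - 1)" for v
    proof -
      have "x \<in> reach w \<longleftrightarrow> w \<in> coreach x" for x w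
        by (simp add: reach_def coreach_def converse_relpow[symmetric])
      then have "{w \<in> V. J v \<inter> J w \<noteq> {}} \<subseteq> (\<Union>x\<in>reach v. coreach x)"
        by (auto simp: J_def)
      then have "card {w \<in> V. J v \<inter> J w \<noteq> {}} \<le> card (\<Union>x\<in>reach v. coreach x)"
        using reach coreach by (intro card_mono) auto
      also have "\<dots> \<le> (\<Sum>x\<in>reach v. card (coreach x))"
        using reach by (intro card_UN_le) auto
      also have "\<dots> \<le> card (reach v) * (1 + l * d) ^ (h - 1)"
        using sum_bounded_above[of "reach v" "\<lambda>x. card (coreach x)" "(1 + l * d) ^ (h - 1)"] coreach
        by simp
      also have "\<dots> \<le> (1 + l * a) ^ (h - 1) * (1 + l * d) ^ (h - 1)"
        using reach by (intro mult_right_mono) auto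
      finally show ?thesis unfolding power_mult_distrib .
    qed
    show "4 * p * real (((1 + l * a) * (1 + l * d)) ^ (h - 1)) \<le> 1"
    proof -
      define M where "M = ((1 + l * a) * (1 + l * d)) ^ (h - 1)"
      have "real (4 * 2 ^ l * a ^ r * M) \<le> real (s ^ r)"
        using small unfolding M_def by (rule of_nat_mono)
      then have "4 * 2 ^ l * real a ^ r * real M \<le> real s ^ r"
        by (simp only: of_nat_mult of_nat_power of_nat_numeral)
      then have "4 * 2 ^ l * real a ^ r * real M / real s ^ r \<le> 1"
        using s by (simp add: divide_le_eq_1_pos)
      then show ?thesis unfolding p_def M_def[symmetric] by (simp add: mult.assoc)
    qed
  qed (use V s in \<open>auto simp: B_def p_def\<close>)
  then show ?thesis by (auto simp: B_def not_less)
qed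

end

section \<open>From claims to list colourings\<close>

text \<open>The two applications of the local lemma fit together: the first leaves every vertex at
  least \<open>16 * b\<close> claims, and conflicts between claims join vertices of equal level, of
  which there are at most \<open>b\<close> per vertex and colour. This is the situation of
  \<open>list_coloring_bounded_conflicts\<close>.\<close>

lemma list_coloring_levels:
  fixes V :: "'v set" and L :: "'v \<Rightarrow> nat set" and E :: "nat \<Rightarrow> ('v \<times> 'v) set"
  assumes V: "finite V" and cardL: "\<And>v. v \<in> V \<Longrightarrow> finite (L v) \<and> card (L v) = l"
    and E: "\<And>i. sym (E i)" "\<And>i. irrefl (E i)" "\<And>u v i. (u, v) \<in> E i \<Longrightarrow> u \<in> V \<and> i \<in> L u"
    and lev: "\<And>i v. lev i v < h" and h: "1 \<le> h"
    and up: "\<And>v i. card {u. (v, u) \<in> E i \<and> lev i u < lev i v} \<le> a"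
    and same: "\<And>v i. card {u. (v, u) \<in> E i \<and> lev i u = lev i v} \<le> b"
    and deg: "\<And>v i. card {u. (v, u) \<in> E i} \<le> d"
    and s: "0 < s" and b: "1 \<le> b" and r: "r + h * (s * (16 * b)) \<le> l"
    and small: "4 * 2 ^ l * a ^ r * ((1 + l * a) * (1 + l * d)) ^ (h - 1) \<le> s ^ r"
  shows "\<exists>c. (\<forall>v \<in> V. c v \<in> L v) \<and> (\<forall>u \<in> V. \<forall>v \<in> V. (u, v) \<in> E (c u) \<longrightarrow> c u \<noteq> c v)"
proof -
  interpret P: claim_process V L E lev h s "16 * b"
  proof
    show "u \<in> V \<and> v \<in> V \<and> i \<in> L u \<and> i \<in> L v" if "(u, v) \<in> E i" for u v i
      using E(1)[of i] E(3) that by (auto dest: symD)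
  qed (use V cardL lev s in auto)
  have deg': "card {u. (u, v) \<in> E i} \<le> d" for v i
  proof -
    have "{u. (u, v) \<in> E i} = {u. (v, u) \<in> E i}" using E(1)[of i] by (auto dest: symD)
    then show ?thesis using deg by simp
  qed
  obtain X where X: "X \<in> P.choices" "\<And>v. v \<in> V \<Longrightarrow> 16 * b \<le> card (P.claimed X h v)"
    using P.exists_all_claiming[OF _ r up deg' h small] cardL by blast
  define E' where "E' i = {(u, v) \<in> E i. i \<in> P.claimed X h u \<and> i \<in> P.claimed X h v}" for i
  have "\<exists>c. (\<forall>v \<in> V. c v \<in> P.claimed X h v) \<and> (\<forall>u \<in> V. \<forall>v \<in> V. (u, v) \<in> E' (c u) \<longrightarrow> c u \<noteq> c v)"
  proof (rule list_coloring_bounded_conflicts[OF V b X(2)])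
    show "sym (E' i)" for i using E(1)[of i] by (auto simp: E'_def sym_def)
    show "irrefl (E' i)" for i using E(2)[of i] by (auto simp: E'_def irrefl_def)
    show "card {u \<in> V. (v, u) \<in> E' i} \<le> b" for v i
    proof -
      have "{u \<in> V. (v, u) \<in> E' i} \<subseteq> {u. (v, u) \<in> E i \<and> lev i u = lev i v}"
        using P.claimed_conflict_same_level[OF X(1) E(1)] by (fastforce simp: E'_def)
      moreover have "finite {u. (v, u) \<in> E i \<and> lev i u = lev i v}"
        using P.E by (intro finite_subset[OF _ V]) auto
      ultimately show ?thesis using same[of v i] card_mono order_trans by blast
    qed
  qed
  then obtain c where c: "\<And>v. v \<in> V \<Longrightarrow> c v \<in> P.claimed X h v"
    "\<And>u v. u \<in> V \<Longrightarrow> v \<in> V \<Longrightarrow> (u, v) \<in> E' (c u) \<Longrightarrow> c u \<noteq> c v" by blast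
  have "c u \<noteq> c v" if uv: "u \<in> V" "v \<in> V" "(u, v) \<in> E (c u)" for u v
  proof
    assume "c u = c v"
    then have "(u, v) \<in> E' (c u)" using c(1)[OF uv(1)] c(1)[OF uv(2)] uv(3) by (simp add: E'_def)
    then show False using c(2)[OF uv(1,2)] \<open>c u = c v\<close> by blast
  qed
  then show ?thesis using c(1) P.claimedD(1)[OF X(1)] by blast
qed

section \<open>Choice of the parameters\<close>

text \<open>With \<open>x = ln d\<close>, the inequality is the logarithm of the assumption
  \<open>small\<close> of \<open>list_coloring_levels\<close>. Here \<open>r\<close> is about
  \<open>\<kappa> * x / ln x\<close> and \<open>ln (s / (h * t))\<close> about
  \<open>(1 - 2 * \<epsilon> - \<eta>) * ln x\<close>. Their product has to beat
  \<open>(h - 1) * x\<close>, the contribution of the degree; all other terms are of smaller order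
  than \<open>x\<close>.\<close>

lemma eventually_parameters:
  fixes \<epsilon> \<delta> :: real and h :: nat
  assumes "0 < \<epsilon>" "\<epsilon> < 1/2" "1 \<le> h" "0 < \<delta>"
  defines "\<eta> \<equiv> (1 - 2 * \<epsilon>) * \<delta> / (2 * (real h - 1 + \<delta>))"
  defines "l \<equiv> (\<lambda>x. nat \<lfloor>(real h - 1 + \<delta>) / (1 - 2 * \<epsilon>) * (x / ln x)\<rfloor>)"
    and "t \<equiv> (\<lambda>x. nat \<lfloor>x powr \<epsilon>\<rfloor>)" and "s \<equiv> (\<lambda>x. nat \<lfloor>x powr (1 - \<epsilon> - \<eta>)\<rfloor>)"
  shows "\<forall>\<^sub>F x in at_top. 1 \<le> t x \<and> 0 < s x \<and> h * (s x * (16 * t x)) \<le> l x \<and>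
    ln 4 + real (l x) * ln 2 + real (l x - h * (s x * (16 * t x))) * ln (real (h * t x))
      + real (h - 1) * (ln (1 + real (l x) * real (h * t x)) + ln (1 + real (l x) * exp x))
    \<le> real (l x - h * (s x * (16 * t x))) * ln (real (s x))"
proof -
  define \<kappa> where "\<kappa> = (real h - 1 + \<delta>) / (1 - 2 * \<epsilon>)"
  have pos: "0 < 1 - 2 * \<epsilon>" "0 < real h - 1 + \<delta>" "0 < \<kappa>" "0 < \<eta>"
    using assms(1-4) by (auto simp: \<kappa>_def \<eta>_def)
  have "(1 - 2 * \<epsilon>) * \<delta> \<le> (1 - 2 * \<epsilon>) * (real h - 1 + \<delta>)"
    using assms(3) pos by (intro mult_left_mono) auto
  then have "\<eta> \<le> (1 - 2 * \<epsilon>) / 2"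
    unfolding \<eta>_def using pos by (subst pos_divide_le_eq) (auto simp only: mult.assoc, simp)
  then have \<eta>: "0 < \<eta>" "0 < 1 - 2 * \<epsilon> - \<eta>" "0 < 1 - \<epsilon> - \<eta>" using pos assms(1-4) by auto
  \<comment> \<open>The value of \<eta> is made for this identity: half of \<delta> is spent on
    \<eta>, the other half remains as the margin over \<open>h - 1\<close>.\<close>
  have \<kappa>\<eta>: "\<kappa> * (1 - 2 * \<epsilon> - \<eta>) = real h - 1 + \<delta> / 2"
  proof -
    have "m / \<beta> * (\<beta> - \<beta> * \<delta> / (2 * m)) = m - \<delta> / 2" if "0 < m" "0 < \<beta>" for m \<beta> :: real
      using that by (simp add: field_simps)
    from this[OF pos(2,1)] show ?thesis unfolding \<kappa>_def \<eta>_def by simp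
  qed
  \<comment> \<open>Smooth lower bounds: \<rho> for the number of blocked colours, where the floor
    in \<open>l\<close> costs 1, and \<open>w\<close> for \<open>ln (s / (h * t))\<close>, where the
    factor 2 pays for rounding \<open>s\<close> down.\<close>
  define \<rho> where "\<rho> x = \<kappa> * (x / ln x) - 1 - 16 * real h * x powr (1 - \<eta>)" for x
  define w where "w x = (1 - 2 * \<epsilon> - \<eta>) * ln x - ln (2 * real h)" for x
  have h0: "0 < real h" using assms(3) by simp
  have lim_\<rho>: "((\<lambda>x. \<rho> x / (x / ln x)) \<longlongrightarrow> \<kappa>) at_top"
    unfolding \<rho>_def using pos h0 \<eta> by real_asymp
  have lim_w: "((\<lambda>x. w x / ln x) \<longlongrightarrow> 1 - 2 * \<epsilon> - \<eta>) at_top"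
  proof -
    define c C where "c = 1 - 2 * \<epsilon> - \<eta>" and "C = ln (2 * real h)"
    have "((\<lambda>x. (c * ln x - C) / ln x) \<longlongrightarrow> c) at_top" by real_asymp
    then show ?thesis by (simp add: w_def c_def C_def)
  qed
  have lim1: "((\<lambda>x. (ln 4 + \<kappa> * (x / ln x) * ln 2) / x) \<longlongrightarrow> 0) at_top"
    by real_asymp
  have lim2: "((\<lambda>x. ln (1 + x * (real h * x)) / x) \<longlongrightarrow> 0) at_top"
    using h0 by real_asymp
  have lim3: "((\<lambda>x::real. ln (1 + x * exp x) / x) \<longlongrightarrow> 1) at_top"
    by real_asymp
  \<comment> \<open>Divided by \<open>x\<close>, the difference of the two sides tends to
    \<open>\<delta> / 2\<close>, which is positive.\<close>
  have "((\<lambda>x. (\<rho> x / (x / ln x)) * (w x / ln x) - ((ln 4 + \<kappa> * (x / ln x) * ln 2) / x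
      + (real h - 1) * (ln (1 + x * (real h * x)) / x + ln (1 + x * exp x) / x)))
      \<longlongrightarrow> \<kappa> * (1 - 2 * \<epsilon> - \<eta>) - (0 + (real h - 1) * (0 + 1))) at_top"
    by (intro tendsto_intros lim_\<rho> lim_w lim1 lim2 lim3)
  then have "\<forall>\<^sub>F x in at_top. 0 < (\<rho> x / (x / ln x)) * (w x / ln x) - ((ln 4 + \<kappa> * (x / ln x) * ln 2) / x
      + (real h - 1) * (ln (1 + x * (real h * x)) / x + ln (1 + x * exp x) / x))"
    by (rule order_tendstoD(1)) (use assms(4) in \<open>simp add: \<kappa>\<eta>\<close>)
  moreover have "\<forall>\<^sub>F x in at_top. 0 < \<rho> x"
  proof -
    have "\<forall>\<^sub>F x in at_top. 0 < \<rho> x / (x / ln x)"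
      by (rule order_tendstoD(1)[OF lim_\<rho> pos(3)])
    moreover have "\<forall>\<^sub>F x::real in at_top. 0 < x / ln x" by real_asymp
    ultimately show ?thesis by eventually_elim (metis zero_less_divide_iff less_asym)
  qed
  moreover have "\<forall>\<^sub>F x in at_top. 0 < w x"
  proof -
    have "\<forall>\<^sub>F x in at_top. 0 < w x / ln x"
      by (rule order_tendstoD(1)[OF lim_w \<eta>(2)])
    moreover have "\<forall>\<^sub>F x::real in at_top. 0 < ln x" by real_asymp
    ultimately show ?thesis by eventually_elim (metis zero_less_divide_iff less_asym)
  qed
  moreover have "\<forall>\<^sub>F x in at_top. 2 \<le> x powr (1 - \<epsilon> - \<eta>)" using \<eta> by real_asymp
  moreover have "\<forall>\<^sub>F x in at_top. 1 \<le> x powr \<epsilon>" using assms(1) by real_asymp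
  moreover have "\<forall>\<^sub>F x::real in at_top. \<kappa> < ln x" by real_asymp
  moreover have "\<forall>\<^sub>F x::real in at_top. 3 < x" by real_asymp
  ultimately show ?thesis
  proof eventually_elim
    case (elim x)
    have x: "0 < x" "1 \<le> x" and lnx: "0 < ln x" using elim pos by auto
    have "0 < x * ((\<rho> x / (x / ln x)) * (w x / ln x) - ((ln 4 + \<kappa> * (x / ln x) * ln 2) / x
        + (real h - 1) * (ln (1 + x * (real h * x)) / x + ln (1 + x * exp x) / x)))"
      using x(1) elim(1) by (rule mult_pos_pos)
    also have "\<dots> = \<rho> x * w x - (ln 4 + \<kappa> * (x / ln x) * ln 2
        + (real h - 1) * (ln (1 + x * (real h * x)) + ln (1 + x * exp x)))"
    proof -
      have "y * (R / (y / z) * (W / z) - (A / y + n * (B / y + C / y))) = R * W - (A + n * (B + C))"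
        if "0 < y" "0 < z" for y z R W A n B C :: real
        using that by (simp add: field_simps)
      from this[OF x(1) lnx] show ?thesis .
    qed
    finally have key: "ln 4 + \<kappa> * (x / ln x) * ln 2
        + (real h - 1) * (ln (1 + x * (real h * x)) + ln (1 + x * exp x)) < \<rho> x * w x" by simp
    have t_le: "real (t x) \<le> x powr \<epsilon>"
      unfolding t_def by (intro of_nat_floor) simp
    have t1: "1 \<le> t x"
      unfolding t_def using elim(5) by (simp add: le_nat_floor)
    have s_le: "real (s x) \<le> x powr (1 - \<epsilon> - \<eta>)"
      unfolding s_def by (intro of_nat_floor) simp
    have s_ge: "x powr (1 - \<epsilon> - \<eta>) / 2 \<le> real (s x)"
      unfolding s_def using elim(4) by linarith
    have s_pos: "0 < s x"
      using s_ge elim(4) by simp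
    have "0 \<le> \<kappa> * (x / ln x)" using pos x lnx by simp
    then have l_le: "real (l x) \<le> \<kappa> * (x / ln x)" and l_ge: "\<kappa> * (x / ln x) - 1 < real (l x)"
      unfolding l_def \<kappa>_def[symmetric] by linarith+
    define N where "N = h * (s x * (16 * t x))"
    have "real N = 16 * real h * (real (s x) * real (t x))"
      by (simp add: N_def)
    also have "\<dots> \<le> 16 * real h * (x powr (1 - \<epsilon> - \<eta>) * x powr \<epsilon>)"
      using s_le t_le by (intro mult_left_mono mult_mono) auto
    also have "x powr (1 - \<epsilon> - \<eta>) * x powr \<epsilon> = x powr (1 - \<eta>)"
      by (simp add: powr_add[symmetric])
    finally have N_le: "real N \<le> 16 * real h * x powr (1 - \<eta>)" .
    have Nl: "N \<le> l x"
      using N_le l_ge elim(2) unfolding \<rho>_def by linarith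
    have r_ge: "\<rho> x \<le> real (l x - N)"
      using N_le l_ge Nl unfolding \<rho>_def by (simp add: of_nat_diff)
    have "ln (real (h * t x)) \<le> ln (real h * x powr \<epsilon>)"
      using t_le t1 h0 by (intro ln_mono) auto
    also have "\<dots> = ln (real h) + \<epsilon> * ln x"
      using h0 x by (simp add: ln_mult ln_powr)
    finally have ln_t: "ln (real (h * t x)) \<le> ln (real h) + \<epsilon> * ln x" .
    have "(1 - \<epsilon> - \<eta>) * ln x - ln 2 = ln (x powr (1 - \<epsilon> - \<eta>) / 2)"
      using x by (simp add: ln_div ln_powr)
    also have "\<dots> \<le> ln (real (s x))"
      using s_ge x by (intro ln_mono) auto
    finally have ln_s: "(1 - \<epsilon> - \<eta>) * ln x - ln 2 \<le> ln (real (s x))" .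
    have "w x \<le> ln (real (s x)) - ln (real (h * t x))"
      using ln_s ln_t h0 by (simp add: w_def ln_mult algebra_simps)
    then have main: "\<rho> x * w x \<le> real (l x - N) * (ln (real (s x)) - ln (real (h * t x)))"
      using r_ge elim by (intro mult_mono) auto
    \<comment> \<open>From here on \<open>l\<close> is replaced by the cruder bound \<open>x\<close>
      inside logarithms, where polynomial factors do not matter.\<close>
    have "\<kappa> * (x / ln x) \<le> x"
      using elim(6) x lnx by (simp add: field_simps)
    then have lx: "real (l x) \<le> x" using l_le by simp
    have "x powr \<epsilon> \<le> x powr 1"
      using x assms(2) by (intro powr_mono) auto
    then have "real (h * t x) \<le> real h * x"
      using t_le x by (simp add: mult_left_mono)
    then have "real (l x) * real (h * t x) \<le> x * (real h * x)"
      using lx x by (intro mult_mono) auto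
    moreover have "0 \<le> real (l x) * real (h * t x)" by simp
    ultimately have "ln (1 + real (l x) * real (h * t x)) \<le> ln (1 + x * (real h * x))"
      by (intro ln_mono) linarith+
    moreover have "ln (1 + real (l x) * exp x) \<le> ln (1 + x * exp x)"
      using lx by (intro ln_mono) (auto intro: add_pos_nonneg)
    ultimately have "real (h - 1) * (ln (1 + real (l x) * real (h * t x)) + ln (1 + real (l x) * exp x))
        \<le> (real h - 1) * (ln (1 + x * (real h * x)) + ln (1 + x * exp x))"
      using assms(3) by (intro mult_mono) (auto simp: of_nat_diff intro!: add_nonneg_nonneg ln_ge_zero)
    moreover have "real (l x) * ln 2 \<le> \<kappa> * (x / ln x) * ln 2"
      using l_le by (intro mult_right_mono) auto
    ultimately have "ln 4 + real (l x) * ln 2 + real (l x - N) * ln (real (h * t x))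
        + real (h - 1) * (ln (1 + real (l x) * real (h * t x)) + ln (1 + real (l x) * exp x))
      \<le> real (l x - N) * ln (real (s x))"
      using key main unfolding right_diff_distrib by linarith
    then show ?case
      using t1 s_pos Nl by (simp add: N_def)
  qed
qed

section \<open>From list colourings to the bound on \<open>ell\<close>\<close>

text \<open>Colours are the indices of the graphs. If no edge of graph \<open>i\<close> has both
  ends coloured \<open>i\<close>, the colour classes are independent sets of their graphs and cover
  all vertices.\<close>

lemma coop_property_good_partition:
  fixes H :: "'v graph set"
  assumes h: "1 \<le> h" and H: "\<And>G. G \<in> H \<Longrightarrow> good_partition_graph G t h"
    and t: "1 \<le> nat \<lfloor>t\<rfloor>" and s: "0 < s" and r: "r + h * (s * (16 * nat \<lfloor>t\<rfloor>)) \<le> l"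
    and small: "4 * 2 ^ l * (h * nat \<lfloor>t\<rfloor>) ^ r * ((1 + l * (h * nat \<lfloor>t\<rfloor>)) * (1 + l * d)) ^ (h - 1) \<le> s ^ r"
  shows "coop_property H d l"
  unfolding coop_property_def
proof (intro allI impI, elim conjE)
  fix k and Gs :: "nat \<Rightarrow> 'v graph"
  assume Gs: "\<forall>i<k. Gs i \<in> H \<and> wf_graph (Gs i) \<and> max_degree_le (Gs i) d"
    and many: "\<forall>v\<in>(\<Union>i<k. verts (Gs i)). l \<le> card {i. i < k \<and> v \<in> verts (Gs i)}"
  define V where "V = (\<Union>i<k. verts (Gs i))"
  have finV: "finite V" using Gs by (auto simp: V_def wf_graph_def)
  define P where "P i f \<longleftrightarrow> (\<forall>x. f x < h)
      \<and> (\<forall>x. card {y. (x, y) \<in> edges (Gs i) \<and> f y < f x} \<le> h * nat \<lfloor>t\<rfloor>)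
      \<and> (\<forall>x. card {y. (x, y) \<in> edges (Gs i) \<and> f y = f x} \<le> nat \<lfloor>t\<rfloor>)" for i and f :: "'v \<Rightarrow> nat"
  have "\<exists>f. P i f" if "i < k" for i
  proof -
    have "wf_graph (Gs i)" "good_partition_graph (Gs i) t h" using Gs H that by auto
    then show ?thesis
      by (rule good_partition_graph_levels[OF _ _ h]) (auto simp: P_def)
  qed
  then obtain lev where "\<And>i. i < k \<Longrightarrow> P i (lev i)" by metis
  then have lev: "\<And>i x. i < k \<Longrightarrow> lev i x < h"
    "\<And>i x. i < k \<Longrightarrow> card {y. (x, y) \<in> edges (Gs i) \<and> lev i y < lev i x} \<le> h * nat \<lfloor>t\<rfloor>"
    "\<And>i x. i < k \<Longrightarrow> card {y. (x, y) \<in> edges (Gs i) \<and> lev i y = lev i x} \<le> nat \<lfloor>t\<rfloor>"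
    by (simp_all add: P_def)
  \<comment> \<open>A vertex may lie in more than \<open>l\<close> graphs; lists of length exactly
    \<open>l\<close> are what the counting of blocked sets works with.\<close>
  have "\<exists>L. L \<subseteq> {i. i < k \<and> v \<in> verts (Gs i)} \<and> card L = l" if "v \<in> V" for v
    using many that obtain_subset_with_card_n unfolding V_def by metis
  then obtain L where L: "\<And>v. v \<in> V \<Longrightarrow> L v \<subseteq> {i. i < k \<and> v \<in> verts (Gs i)}" "\<And>v. v \<in> V \<Longrightarrow> card (L v) = l"
    by metis
  define E where "E i = {(u, v) \<in> edges (Gs i). i < k \<and> i \<in> L u \<and> i \<in> L v}" for i
  \<comment> \<open>Indices from \<open>k\<close> on have no edges in \<open>E\<close>; level 0
    there meets the bound on levels, which is required for every index.\<close>
  define lev' where "lev' i v = (if i < k then lev i v else 0)" for i v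
  have fine: "finite {y. (x, y) \<in> edges (Gs i)}" "edges (Gs i) \<subseteq> V \<times> V"
    "sym (edges (Gs i))" "irrefl (edges (Gs i))" if "i < k" for i x
  proof -
    have wf: "finite (verts (Gs i))" "edges (Gs i) \<subseteq> verts (Gs i) \<times> verts (Gs i)"
      "sym (edges (Gs i))" "irrefl (edges (Gs i))"
      using Gs that by (auto simp: wf_graph_def)
    then show "sym (edges (Gs i))" "irrefl (edges (Gs i))" by blast+
    show "edges (Gs i) \<subseteq> V \<times> V" using wf(2) that by (auto simp: V_def)
    show "finite {y. (x, y) \<in> edges (Gs i)}"
      using wf(1) by (rule finite_subset[rotated]) (use wf(2) in auto)
  qed
  have "\<exists>c. (\<forall>v \<in> V. c v \<in> L v) \<and> (\<forall>u \<in> V. \<forall>v \<in> V. (u, v) \<in> E (c u) \<longrightarrow> c u \<noteq> c v)"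
  proof (rule list_coloring_levels[OF finV _ _ _ _ _ h _ _ _ s t r small])
    show "finite (L v) \<and> card (L v) = l" if "v \<in> V" for v
      using L[OF that] finite_subset[OF L(1)[OF that]] by auto
    show "sym (E i)" for i
      using fine(3)[of i] by (cases "i < k") (auto simp: E_def sym_def)
    show "irrefl (E i)" for i
      using fine(4)[of i] by (cases "i < k") (auto simp: E_def irrefl_def)
    show "u \<in> V \<and> i \<in> L u" if "(u, v) \<in> E i" for u v i
      using that fine(2)[of i] by (auto simp: E_def)
    show "lev' i v < h" for i v using lev(1) h by (auto simp: lev'_def)
    show "card {u. (v, u) \<in> E i \<and> lev' i u < lev' i v} \<le> h * nat \<lfloor>t\<rfloor>" for v i
    proof (cases "i < k")
      case True
      have "card {u. (v, u) \<in> E i \<and> lev' i u < lev' i v} \<le> card {y. (v, y) \<in> edges (Gs i) \<and> lev i y < lev i v}"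
        using fine(1)[OF True, of v] True by (intro card_mono) (auto simp: E_def lev'_def)
      then show ?thesis using lev(2)[OF True, of v] by simp
    qed (simp add: lev'_def)
    show "card {u. (v, u) \<in> E i \<and> lev' i u = lev' i v} \<le> nat \<lfloor>t\<rfloor>" for v i
    proof (cases "i < k")
      case True
      have "card {u. (v, u) \<in> E i \<and> lev' i u = lev' i v} \<le> card {y. (v, y) \<in> edges (Gs i) \<and> lev i y = lev i v}"
        using fine(1)[OF True, of v] True by (intro card_mono) (auto simp: E_def lev'_def)
      then show ?thesis using lev(3)[OF True, of v] by simp
    qed (simp add: E_def)
    show "card {u. (v, u) \<in> E i} \<le> d" for v i
    proof (cases "i < k \<and> v \<in> verts (Gs i)")
      case True
      have "card {u. (v, u) \<in> E i} \<le> card {u. (v, u) \<in> edges (Gs i)}"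
        using fine(1)[of i v] True by (intro card_mono) (auto simp: E_def)
      also have "\<dots> \<le> d"
        using Gs True by (auto simp: max_degree_le_def degree_def)
      finally show ?thesis .
    next
      case False
      then have "{u. (v, u) \<in> E i} = {}"
        using Gs by (fastforce simp: E_def wf_graph_def)
      then show ?thesis by simp
    qed
  qed
  then obtain c where c: "\<And>v. v \<in> V \<Longrightarrow> c v \<in> L v"
    "\<And>u v. u \<in> V \<Longrightarrow> v \<in> V \<Longrightarrow> (u, v) \<in> E (c u) \<Longrightarrow> c u \<noteq> c v" by blast
  have cL: "c v < k" "v \<in> verts (Gs (c v))" if "v \<in> V" for v
    using c(1)[OF that] L(1)[OF that] by auto
  define R where "R i = {v \<in> V. c v = i}" for i
  have R: "R i \<subseteq> verts (Gs i)" for i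
    using cL by (auto simp: R_def)
  have "independent (Gs i) (R i)" if "i < k" for i
  proof -
    have "(x, y) \<notin> edges (Gs i)" if xy: "x \<in> R i" "y \<in> R i" for x y
    proof
      assume "(x, y) \<in> edges (Gs i)"
      then have "(x, y) \<in> E (c x)"
        using xy c(1)[of x] c(1)[of y] \<open>i < k\<close> by (auto simp: E_def R_def)
      then show False using c(2)[of x y] xy by (auto simp: R_def)
    qed
    then show ?thesis using R by (auto simp: independent_def)
  qed
  moreover have "V = (\<Union>i<k. R i)"
    using cL(1) by (auto simp: R_def)
  ultimately show "coop_colorable k Gs"
    using R unfolding coop_colorable_def V_def[symmetric] by blast
qed

theorem theorem3:
  fixes \<epsilon> :: real and h :: nat
  assumes "0 < \<epsilon>" and "\<epsilon> < 1/2" and "1 \<le> h"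
  shows "\<forall>\<delta>>0. \<exists>D::nat. \<forall>d\<ge>D. \<forall>H :: 'v graph set.
           (\<forall>G\<in>H. good_partition_graph G ((ln (real d)) powr \<epsilon>) h) \<longrightarrow>
           real (ell H d) \<le> (real h - 1 + \<delta>) / (1 - 2 * \<epsilon>) * (ln (real d) / ln (ln (real d)))"
proof (intro allI impI)
  fix \<delta> :: real assume \<delta>: "0 < \<delta>"
  define \<eta> where "\<eta> = (1 - 2 * \<epsilon>) * \<delta> / (2 * (real h - 1 + \<delta>))"
  define l where "l x = nat \<lfloor>(real h - 1 + \<delta>) / (1 - 2 * \<epsilon>) * (x / ln x)\<rfloor>" for x :: real
  define t where "t x = nat \<lfloor>x powr \<epsilon>\<rfloor>" for x :: real
  define s where "s x = nat \<lfloor>x powr (1 - \<epsilon> - \<eta>)\<rfloor>" for x :: real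
  define N where "N x = h * (s x * (16 * t x))" for x
  \<comment> \<open>The parameters are functions of \<open>x = ln d\<close>, so the asymptotic
    inequality is pulled back along the logarithm.\<close>
  have lim: "filterlim (\<lambda>d. ln (real d)) at_top sequentially"
    by (rule filterlim_compose[OF ln_at_top filterlim_real_sequentially])
  have "\<forall>\<^sub>F d in sequentially. 1 \<le> t (ln d) \<and> 0 < s (ln d) \<and> N (ln d) \<le> l (ln d) \<and>
    ln 4 + real (l (ln d)) * ln 2 + real (l (ln d) - N (ln d)) * ln (real (h * t (ln d)))
      + real (h - 1) * (ln (1 + real (l (ln d)) * real (h * t (ln d))) + ln (1 + real (l (ln d)) * exp (ln d)))
    \<le> real (l (ln d) - N (ln d)) * ln (real (s (ln d)))"
    using eventually_compose_filterlim[OF eventually_parameters[OF assms \<delta>] lim]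
    by (simp only: l_def t_def s_def \<eta>_def N_def)
  moreover have "\<forall>\<^sub>F d in sequentially. 3 \<le> d" by (rule eventually_ge_at_top)
  ultimately have "\<forall>\<^sub>F d in sequentially. \<forall>H :: 'v graph set.
      (\<forall>G\<in>H. good_partition_graph G ((ln (real d)) powr \<epsilon>) h) \<longrightarrow>
      real (ell H d) \<le> (real h - 1 + \<delta>) / (1 - 2 * \<epsilon>) * (ln (real d) / ln (ln (real d)))"
  proof eventually_elim
    case (elim d)
    define a r where "a = h * t (ln d)" and "r = l (ln d) - N (ln d)"
    let ?l = "l (ln d)" and ?s = "s (ln d)"
    have d: "0 < d" and a: "0 < a" and s: "0 < ?s"
      using elim assms(3) by (auto simp: a_def)
    have log: "ln 4 + real ?l * ln 2 + real r * ln (real a)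
      + real (h - 1) * (ln (1 + real ?l * real a) + ln (1 + real ?l * real d)) \<le> real r * ln (real ?s)"
    proof -
      have "exp (ln (real d)) = real d" using d by simp
      from elim(1)[unfolded this] show ?thesis unfolding a_def r_def by blast
    qed
    define A where "A = 1 + real ?l * real a"
    define B where "B = 1 + real ?l * real d"
    have AB: "0 < A" "0 < B" by (auto simp: A_def B_def intro: add_pos_nonneg)
    \<comment> \<open>All factors are positive, so \<open>log\<close> can be exponentiated into the
      integer inequality \<open>small\<close>.\<close>
    have "ln (4 * 2 ^ ?l * real a ^ r * (A * B) ^ (h - 1)) \<le> ln (real ?s ^ r)"
      using log a s AB by (simp add: ln_mult ln_realpow A_def[symmetric] B_def[symmetric] del: of_nat_diff)
    then have "4 * 2 ^ ?l * real a ^ r * (A * B) ^ (h - 1) \<le> real ?s ^ r"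
      using a s AB by (subst (asm) ln_le_cancel_iff) auto
    then have "real (4 * 2 ^ ?l * a ^ r * ((1 + ?l * a) * (1 + ?l * d)) ^ (h - 1)) \<le> real (?s ^ r)"
      by (simp only: A_def B_def of_nat_mult of_nat_power of_nat_add of_nat_numeral of_nat_1)
    then have small: "4 * 2 ^ ?l * a ^ r * ((1 + ?l * a) * (1 + ?l * d)) ^ (h - 1) \<le> ?s ^ r"
      by (simp only: of_nat_le_iff)
    have r: "r + h * (?s * (16 * t (ln d))) \<le> ?l"
      using elim by (simp add: r_def N_def)
    show ?case
    proof (intro allI impI)
      fix H :: "'v graph set"
      assume H: "\<forall>G\<in>H. good_partition_graph G ((ln (real d)) powr \<epsilon>) h"
      have "coop_property H d ?l"
        using H elim r small s assms(3) unfolding a_def t_def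
        by (intro coop_property_good_partition[where t = "ln (real d) powr \<epsilon>" and s = ?s and r = r]) auto
      then have "ell H d \<le> ?l" unfolding ell_def by (rule Least_le)
      moreover have "real ?l \<le> (real h - 1 + \<delta>) / (1 - 2 * \<epsilon>) * (ln d / ln (ln d))"
      proof -
        \<comment> \<open>Makes the real bound nonnegative; for a negative one, \<open>nat\<close>
          would round up to 0 and \<open>?l\<close> would exceed it. It holds because
          \<open>d\<close> is at least 3.\<close>
        have "1 \<le> ln (real d)"
          using elim exp_le by (subst ln_ge_iff) auto
        then have "0 \<le> (real h - 1 + \<delta>) / (1 - 2 * \<epsilon>) * (ln d / ln (ln d))"
          using assms \<delta> by (intro mult_nonneg_nonneg divide_nonneg_nonneg) auto
        then show ?thesis unfolding l_def by (intro of_nat_floor)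
      qed
      ultimately show "real (ell H d) \<le> (real h - 1 + \<delta>) / (1 - 2 * \<epsilon>) * (ln (real d) / ln (ln (real d)))"
        by linarith
    qed
  qed
  then show "\<exists>D::nat. \<forall>d\<ge>D. \<forall>H :: 'v graph set.
           (\<forall>G\<in>H. good_partition_graph G ((ln (real d)) powr \<epsilon>) h) \<longrightarrow>
           real (ell H d) \<le> (real h - 1 + \<delta>) / (1 - 2 * \<epsilon>) * (ln (real d) / ln (ln (real d)))"
    by (simp add: eventually_sequentially)
qed

end
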